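(* Let $\alpha,\beta\in[0,\pi)$ be distinct. Then the quadruple $$\begin{array}{ccc}\mathscr{R}_{\mathsf{H}_\alpha}&\subset&\mathscr{R}\\ \cup&&\cup\\ \mathscr{R}_{\mathsf{H}_\alpha}\cap\mathscr{R}_{\mathsf{H}_\beta}&\subset&\mathscr{R}_{\mathsf{H}_\beta}\end{array}$$ is a commuting square if and only if $\mathrm{d}_{\mathrm{MT}}(\mathscr{R}_{\mathsf{H}_\alpha},\mathscr{R}_{\mathsf{H}_\beta})=1$.
   Context: Let $n\ge 2$; $\mathbb{M}_n$ is the algebra of $n\times n$ complex matrices with matrix units $E_{ij}$ and identity $\mathbb{I}_n$, and $\Delta\subset \mathbb{M}_n$ is the algebra of diagonal matrices. A Hadamard unitary in $\mathbb{M}_n$ is a unitary matrix all of whose entries have modulus $n^{-1/2}$. Ambient factor: $\mathscr{R}$ is the hyperfinite $\mathrm{II}_1$-factor obtained as the weak closure, in the GNS representation of the unique normalized trace $\tau$, of $\bigcup_k \mathbb{M}_n^{\otimes k}$, where $\mathbb{M}_n^{\otimes k}\subset\mathbb{M}_n^{\otimes(k+1)}$ via $x\mapsto x\otimes \mathbb{I}_n$. Spin model subfactor: for a Hadamard unitary $u=(u_{ij})\in\mathbb{M}_n$ put $D_u:=\sqrt n\sum_{i,j}\overline{u_{ij}}\,(E_{jj}\otimes E_{ii})$, $u_1:=(u\otimes \mathbb{I}_n)D_u\in\mathbb{M}_n\otimes\Delta$, and for $k\ge1$, $u_{2k-1}:=\prod_{i=0}^{k-1}\big(\mathbb{I}_n^{\otimes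 i}\otimes u_1\otimes \mathbb{I}_n^{\otimes (k-1-i)}\big)\in\mathbb{M}_n^{\otimes (k+1)}$ (factors ordered from left to right with increasing $i$). The algebras $u_{2k-1}(\mathbb{M}_n^{\otimes k}\otimes \mathbb{I}_n)u_{2k-1}^*$ increase with $k$, and $\mathscr{R}_u\subset\mathscr{R}$ is the weak closure of their union. For $\alpha\in\mathbb{R}$, $\mathsf{H}_\alpha:=\frac{1}{\sqrt2}\begin{pmatrix}1&1\\ e^{i\alpha}&-e^{i\alpha}\end{pmatrix}$, a $2\times2$ Hadamard unitary; here $n=2$. Commuting square: for von Neumann subalgebras $N\subset P,Q\subset M$ of a tracial von Neumann algebra $(M,\tau)$, with $\tau$-preserving conditional expectations $E_N,E_P,E_Q$, the quadruple is a commuting square if $E_PE_Q=E_N=E_QE_P$. Mashood–Taylor distance: for von Neumann subalgebras $P,Q$ of $(M,\tau)$, $\mathrm{d}_{\mathrm{MT}}(P,Q)$ is the Hausdorff distance, with respect to $\|x\|_\tau=\tau(x^*x)^{1/2}$, between the operator-norm closed unit balls of $P$ and $Q$. *)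

theory Defs
  imports
    "HOL-Library.Nonpos_Ints"
    "HOL-Analysis.Bounded_Linear_Function"
    "Jordan_Normal_Form.Schur_Decomposition"
begin

subsection \<open>Complex Hilbert spaces and the weak operator topology\<close>

text \<open>The inner product is linear in its first argument.\<close>

class complex_hilbert_space = banach +
  fixes scaleC :: "complex \<Rightarrow> 'a \<Rightarrow> 'a"  (infixr \<open>*\<^sub>C\<close> 75)
    and cinner :: "'a \<Rightarrow> 'a \<Rightarrow> complex"
  assumes scaleC_add_right: "c *\<^sub>C (x + y) = c *\<^sub>C x + c *\<^sub>C y"
    and scaleC_add_left: "(c + d) *\<^sub>C x = c *\<^sub>C x + d *\<^sub>C x"
    and scaleC_scaleC: "c *\<^sub>C d *\<^sub>C x = (c * d) *\<^sub>C x"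
    and scaleR_scaleC: "r *\<^sub>R x = complex_of_real r *\<^sub>C x"
    and cinner_commute: "cinner x y = cnj (cinner y x)"
    and cinner_add_left: "cinner (x + y) z = cinner x z + cinner y z"
    and cinner_scaleC_left: "cinner (c *\<^sub>C x) y = c * cinner x y"
    and cinner_self: "cinner x x = complex_of_real ((norm x)\<^sup>2)"

instantiation complex :: complex_hilbert_space
begin

definition scaleC_complex :: "complex \<Rightarrow> complex \<Rightarrow> complex"
  where "scaleC_complex c z = c * z"

definition cinner_complex :: "complex \<Rightarrow> complex \<Rightarrow> complex"
  where "cinner_complex w z = w * cnj z"

instance
  by standard
    (auto simp: scaleC_complex_def cinner_complex_def algebra_simps scaleR_conv_of_real
      complex_norm_square simp flip: of_real_power)

end

lemma norm_scaleC:
  fixes x :: "'h::complex_hilbert_space"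
  shows "norm (c *\<^sub>C x) = cmod c * norm x"
proof -
  have "complex_of_real ((norm (c *\<^sub>C x))\<^sup>2) = c * (cnj c * cinner x x)"
    by (metis cinner_commute cinner_scaleC_left cinner_self complex_cnj_mult)
  also have "\<dots> = complex_of_real ((cmod c * norm x)\<^sup>2)"
    using complex_norm_square[of c]
    by (simp add: cinner_self power_mult_distrib flip: mult.assoc)
  finally have "(norm (c *\<^sub>C x))\<^sup>2 = (cmod c * norm x)\<^sup>2"
    unfolding of_real_eq_iff .
  then show ?thesis
    by (simp add: power2_eq_iff_nonneg)
qed

lemma bounded_linear_scaleC:
  "bounded_linear (\<lambda>x::'h::complex_hilbert_space. c *\<^sub>C x)"
  by (rule bounded_linear_intro[where K = "cmod c"])
    (simp_all add: scaleC_add_right scaleR_scaleC scaleC_scaleC norm_scaleC mult.commute)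

text \<open>Operators are elements of the library type of bounded \<^emph>\<open>real\<close>-linear maps; \<open>clinear_op\<close>
  singles out the complex-linear ones.  This set is closed in the weak operator topology.\<close>

definition clinear_op :: "('h::complex_hilbert_space \<Rightarrow>\<^sub>L 'h) \<Rightarrow> bool" where
  "clinear_op T \<longleftrightarrow> (\<forall>c x. blinfun_apply T (c *\<^sub>C x) = c *\<^sub>C blinfun_apply T x)"

definition scalar_op :: "complex \<Rightarrow> ('h::complex_hilbert_space \<Rightarrow>\<^sub>L 'h)" where
  "scalar_op c = Blinfun (\<lambda>x. c *\<^sub>C x)"

definition is_adjoint :: "('h::complex_hilbert_space \<Rightarrow>\<^sub>L 'h) \<Rightarrow> ('h \<Rightarrow>\<^sub>L 'h) \<Rightarrow> bool" where
  "is_adjoint T S \<longleftrightarrow>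
     (\<forall>x y. cinner (blinfun_apply T x) y = cinner x (blinfun_apply S y))"

definition adj_op :: "('h::complex_hilbert_space \<Rightarrow>\<^sub>L 'h) \<Rightarrow> ('h \<Rightarrow>\<^sub>L 'h)" where
  "adj_op T = (THE S. is_adjoint T S)"

definition positive_op :: "('h::complex_hilbert_space \<Rightarrow>\<^sub>L 'h) \<Rightarrow> bool" where
  "positive_op T \<longleftrightarrow> (\<forall>x. cinner (blinfun_apply T x) x \<in> \<real>\<^sub>\<ge>\<^sub>0)"

definition weak_operator_topology :: "('h::complex_hilbert_space \<Rightarrow>\<^sub>L 'h) topology" where
  "weak_operator_topology =
     pullback_topology UNIV (\<lambda>T (x, y). cinner (blinfun_apply T x) y) euclidean"


subsection \<open>Tensor powers of the matrix algebra\<close>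

text \<open>The \<open>k\<close>-th tensor power of the \<open>n \<times> n\<close> matrices is \<open>carrier_mat (n ^ k) (n ^ k)\<close>,
  simple tensors being Kronecker products.\<close>

definition kron :: "complex mat \<Rightarrow> complex mat \<Rightarrow> complex mat"  (infixl \<open>\<otimes>\<^sub>m\<close> 70) where
  "A \<otimes>\<^sub>m B = mat (dim_row A * dim_row B) (dim_col A * dim_col B)
     (\<lambda>(i, j). A $$ (i div dim_row B, j div dim_col B) * B $$ (i mod dim_row B, j mod dim_col B))"

definition mat_unit :: "nat \<Rightarrow> nat \<Rightarrow> nat \<Rightarrow> complex mat" where
  "mat_unit n i j = mat n n (\<lambda>(a, b). if a = i \<and> b = j then 1 else 0)"

definition normalized_trace :: "complex mat \<Rightarrow> complex" where
  "normalized_trace A = (\<Sum>i<dim_row A. A $$ (i, i)) / of_nat (dim_row A)"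


subsection \<open>The hyperfinite factor in the GNS representation of the trace\<close>

text \<open>\<open>gns_trace n \<pi> \<Omega>\<close>: the pair \<open>(\<pi>, \<Omega>)\<close> is a GNS representation, with cyclic vector \<open>\<Omega>\<close>,
  of the normalized trace on the increasing union of the tensor powers, where \<open>a\<close> is identified
  with \<open>a \<otimes>\<^sub>m 1\<^sub>m n\<close>.  For \<open>n \<ge> 2\<close> the tensor power containing a matrix is determined by its
  dimension, so a single function \<open>\<pi>\<close> on matrices of all sizes can be used; its values on
  matrices of other dimensions are irrelevant.\<close>

definition gns_trace ::
    "nat \<Rightarrow> (complex mat \<Rightarrow> ('h::complex_hilbert_space \<Rightarrow>\<^sub>L 'h)) \<Rightarrow> 'h \<Rightarrow> bool" where
  "gns_trace n \<pi> \<Omega> \<longleftrightarrow>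
     (\<forall>k. \<forall>a\<in>carrier_mat (n ^ k) (n ^ k).
        clinear_op (\<pi> a) \<and>
        \<pi> (a \<otimes>\<^sub>m 1\<^sub>m n) = \<pi> a \<and>
        is_adjoint (\<pi> a) (\<pi> (mat_adjoint a)) \<and>
        (\<forall>c. \<pi> (c \<cdot>\<^sub>m a) = scalar_op c o\<^sub>L \<pi> a) \<and>
        (\<forall>b\<in>carrier_mat (n ^ k) (n ^ k).
           \<pi> (a + b) = \<pi> a + \<pi> b \<and> \<pi> (a * b) = \<pi> a o\<^sub>L \<pi> b) \<and>
        cinner (blinfun_apply (\<pi> a) \<Omega>) \<Omega> = normalized_trace a) \<and>
     closure {blinfun_apply (\<pi> a) \<Omega> | a k. a \<in> carrier_mat (n ^ k) (n ^ k)} = UNIV"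

definition hyperfinite_factor ::
    "nat \<Rightarrow> (complex mat \<Rightarrow> ('h::complex_hilbert_space \<Rightarrow>\<^sub>L 'h)) \<Rightarrow> ('h \<Rightarrow>\<^sub>L 'h) set" where
  "hyperfinite_factor n \<pi> =
     weak_operator_topology closure_of (\<Union>k. \<pi> ` carrier_mat (n ^ k) (n ^ k))"

text \<open>The normal extension of the trace to the weak closure is the vector state of \<open>\<Omega>\<close>.\<close>

definition vtrace :: "'h::complex_hilbert_space \<Rightarrow> ('h \<Rightarrow>\<^sub>L 'h) \<Rightarrow> complex" where
  "vtrace \<Omega> x = cinner (blinfun_apply x \<Omega>) \<Omega>"

definition norm2 :: "'h::complex_hilbert_space \<Rightarrow> ('h \<Rightarrow>\<^sub>L 'h) \<Rightarrow> real" where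
  "norm2 \<Omega> x = sqrt (Re (vtrace \<Omega> (adj_op x o\<^sub>L x)))"


subsection \<open>Spin model subfactors\<close>

text \<open>Matrix indices run from \<open>0\<close> to \<open>n - 1\<close>.\<close>

definition spin_D :: "nat \<Rightarrow> complex mat \<Rightarrow> complex mat" where
  "spin_D n u = complex_of_real (sqrt (real n)) \<cdot>\<^sub>m
     mat (n ^ 2) (n ^ 2) (\<lambda>ab. \<Sum>i<n. \<Sum>j<n.
       cnj (u $$ (i, j)) * (mat_unit n j j \<otimes>\<^sub>m mat_unit n i i) $$ ab)"

definition spin_u1 :: "nat \<Rightarrow> complex mat \<Rightarrow> complex mat" where
  "spin_u1 n u = (u \<otimes>\<^sub>m 1\<^sub>m n) * spin_D n u"

text \<open>\<open>spin_u n u k\<close> is the unitary with subscript \<open>2 k - 1\<close> (for \<open>k \<ge> 1\<close>), an element of the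
  \<open>(k + 1)\<close>-st tensor power.  The factors with smaller \<open>i\<close> stand further left.\<close>

definition spin_u :: "nat \<Rightarrow> complex mat \<Rightarrow> nat \<Rightarrow> complex mat" where
  "spin_u n u k =
     foldr (*) (map (\<lambda>i. 1\<^sub>m (n ^ i) \<otimes>\<^sub>m spin_u1 n u \<otimes>\<^sub>m 1\<^sub>m (n ^ (k - 1 - i))) [0..<k])
       (1\<^sub>m (n ^ (k + 1)))"

definition spin_subfactor ::
    "nat \<Rightarrow> (complex mat \<Rightarrow> ('h::complex_hilbert_space \<Rightarrow>\<^sub>L 'h)) \<Rightarrow> complex mat \<Rightarrow>
     ('h \<Rightarrow>\<^sub>L 'h) set" where
  "spin_subfactor n \<pi> u =
     weak_operator_topology closure_of
       (\<Union>k\<in>{1..}. (\<lambda>x. \<pi> (spin_u n u k * (x \<otimes>\<^sub>m 1\<^sub>m n) * mat_adjoint (spin_u n u k)))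
                      ` carrier_mat (n ^ k) (n ^ k))"

definition hadamard2 :: "real \<Rightarrow> complex mat" where
  "hadamard2 \<alpha> = complex_of_real (1 / sqrt 2) \<cdot>\<^sub>m
     mat_of_rows_list 2 [[1, 1], [exp (\<i> * of_real \<alpha>), - exp (\<i> * of_real \<alpha>)]]"


subsection \<open>Commuting squares and the Mashood-Taylor distance\<close>

text \<open>\<open>trace_cond_exp \<Omega> M N E\<close>: on \<open>M\<close>, the map \<open>E\<close> is the trace-preserving conditional
  expectation onto \<open>N\<close>.  Only the values of \<open>E\<close> on \<open>M\<close> are constrained.\<close>

definition trace_cond_exp ::
    "'h::complex_hilbert_space \<Rightarrow> ('h \<Rightarrow>\<^sub>L 'h) set \<Rightarrow> ('h \<Rightarrow>\<^sub>L 'h) set \<Rightarrow>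
     (('h \<Rightarrow>\<^sub>L 'h) \<Rightarrow> ('h \<Rightarrow>\<^sub>L 'h)) \<Rightarrow> bool" where
  "trace_cond_exp \<Omega> M N E \<longleftrightarrow>
     (\<forall>x\<in>M. E x \<in> N) \<and>
     (\<forall>x\<in>N. E x = x) \<and>
     (\<forall>x\<in>M. \<forall>y\<in>M. E (x + y) = E x + E y) \<and>
     (\<forall>c. \<forall>x\<in>M. E (scalar_op c o\<^sub>L x) = scalar_op c o\<^sub>L E x) \<and>
     (\<forall>x\<in>M. positive_op x \<longrightarrow> positive_op (E x)) \<and>
     (\<forall>a\<in>N. \<forall>b\<in>N. \<forall>x\<in>M. E (a o\<^sub>L x o\<^sub>L b) = a o\<^sub>L E x o\<^sub>L b) \<and>
     (\<forall>x\<in>M. vtrace \<Omega> (E x) = vtrace \<Omega> x)"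

text \<open>For von Neumann subalgebras \<open>N \<subseteq> P, Q \<subseteq> M\<close> the trace-preserving conditional expectations
  exist and are unique on \<open>M\<close>, so the existential quantifier only names them.\<close>

definition commuting_square ::
    "'h::complex_hilbert_space \<Rightarrow> ('h \<Rightarrow>\<^sub>L 'h) set \<Rightarrow> ('h \<Rightarrow>\<^sub>L 'h) set \<Rightarrow> ('h \<Rightarrow>\<^sub>L 'h) set \<Rightarrow>
     ('h \<Rightarrow>\<^sub>L 'h) set \<Rightarrow> bool" where
  "commuting_square \<Omega> M P Q N \<longleftrightarrow>
     N \<subseteq> P \<and> N \<subseteq> Q \<and> P \<subseteq> M \<and> Q \<subseteq> M \<and>
     (\<exists>E\<^sub>N E\<^sub>P E\<^sub>Q. trace_cond_exp \<Omega> M N E\<^sub>N \<and> trace_cond_exp \<Omega> M P E\<^sub>P \<and> trace_cond_exp \<Omega> M Q E\<^sub>Q \<and>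
        (\<forall>x\<in>M. E\<^sub>P (E\<^sub>Q x) = E\<^sub>N x \<and> E\<^sub>Q (E\<^sub>P x) = E\<^sub>N x))"

definition op_unit_ball :: "('h::complex_hilbert_space \<Rightarrow>\<^sub>L 'h) set \<Rightarrow> ('h \<Rightarrow>\<^sub>L 'h) set" where
  "op_unit_ball P = {x \<in> P. norm x \<le> 1}"

definition dist_MT ::
    "'h::complex_hilbert_space \<Rightarrow> ('h \<Rightarrow>\<^sub>L 'h) set \<Rightarrow> ('h \<Rightarrow>\<^sub>L 'h) set \<Rightarrow> real" where
  "dist_MT \<Omega> P Q =
     max (SUP x\<in>op_unit_ball P. INF y\<in>op_unit_ball Q. norm2 \<Omega> (x - y))
         (SUP y\<in>op_unit_ball Q. INF x\<in>op_unit_ball P. norm2 \<Omega> (x - y))"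

end

theory Submission
  imports Defs
begin

text \<open>Put \<open>\<sigma>\<^sub>\<alpha> = cos \<alpha> X + sin \<alpha> Y\<close>, a self-adjoint unitary combination of Pauli matrices, and let
  \<open>\<theta>\<^sub>\<alpha> = Ad (\<sigma>\<^sub>\<alpha> \<otimes> X \<otimes> X \<otimes> \<dots>)\<close>, an automorphism of period two of the hyperfinite factor \<open>R\<close>.  The
  whole proof rests on the identification of \<open>R\<^bsub>H\<^sub>\<alpha>\<^esub>\<close> with the fixed-point algebra of \<open>\<theta>\<^sub>\<alpha>\<close>.
  The spin unitary on \<open>k + 1\<close> sites conjugates \<open>\<sigma>\<^sub>\<alpha>\<close> on the last site into the parity operator
  \<open>W\<^sub>k = \<sigma>\<^sub>\<alpha> \<otimes> X \<otimes> \<dots> \<otimes> X\<close> (\<open>spin_u_intertwines\<close>) and commutes with the Pauli matrix \<open>Z\<close> on the last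
  site (\<open>spin_u_phase_flip\<close>).  As \<open>Z\<close> and \<open>\<sigma>\<^sub>\<alpha>\<close> generate all two by two matrices, conjugating
  \<open>M \<otimes> 1\<close> gives the commutant of \<open>W\<^sub>k\<close> and \<open>Z\<close>, and in the union over \<open>k\<close> this is the set of
  all \<open>\<theta>\<^sub>\<alpha>\<close>-invariant matrices.  The automorphism is implemented on the GNS space by a self-adjoint
  unitary \<open>V\<^sub>\<alpha>\<close> fixing \<open>\<Omega>\<close>, so it extends to the weak closures, and \<open>E\<^sub>\<alpha> = (1 + \<theta>\<^sub>\<alpha>) / 2\<close> is the
  trace-preserving conditional expectation onto \<open>R\<^bsub>H\<^sub>\<alpha>\<^esub>\<close> (\<open>E_trace_cond_exp\<close>).

  Write \<open>\<gamma> = \<alpha> - \<beta>\<close>.  The product \<open>\<sigma>\<^sub>\<beta> \<sigma>\<^sub>\<alpha>\<close> is \<open>cos \<gamma> + \<i> sin \<gamma> Z\<close>, and the product of the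
  parity operators of equal length for \<open>\<beta>\<close> and \<open>\<alpha>\<close>, in this order, is the same matrix on the first
  site, because the tails cancel (\<open>parity_mult\<close>).  Both sides of the theorem turn out to be
  equivalent to \<open>cos \<gamma> = 0\<close>.

  \<^item> If \<open>cos \<gamma> = 0\<close>, the parity operators anticommute, so the automorphisms and hence the conditional
    expectations commute.  Conversely, in a commuting square \<open>z = E\<^sub>P (\<sigma>\<^sub>\<beta>)\<close> lies in both algebras.
    As \<open>sin \<gamma> \<noteq> 0\<close>, invariance under both automorphisms makes \<open>z\<close> orthogonal to every \<open>\<sigma>\<^sub>t\<close>, whereas the
    conditional expectation gives \<open>\<tau> (\<sigma>\<^sub>\<alpha> z) = \<tau> (\<sigma>\<^sub>\<alpha> \<sigma>\<^sub>\<beta>) = cos \<gamma>\<close>.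

  \<^item> For \<open>x\<close> in the unit ball of the first algebra, \<open>E\<^sub>\<beta> x\<close> is in the unit ball of the second and
    \<open>x - E\<^sub>\<beta> x = (x - \<theta>\<^sub>\<beta> (\<theta>\<^sub>\<alpha> x)) / 2\<close>.  The formula for the product of parity operators turns this
    difference into \<open>\<i> sin \<gamma> / 2\<close> times a commutator with \<open>Z\<close>, up to a unitary factor, so the distance
    is at most \<open>\<bar>sin \<gamma>\<bar>\<close> (\<open>dist_MT_le\<close>).  If \<open>cos \<gamma> = 0\<close>, then \<open>\<theta>\<^sub>\<beta>\<close> maps \<open>\<sigma>\<^sub>\<alpha>\<close> to \<open>- \<sigma>\<^sub>\<alpha>\<close>; thus
    \<open>\<sigma>\<^sub>\<alpha>\<close> is orthogonal to the second algebra and the distance is at least 1.\<close>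

section \<open>Adjoints and isometries on complex Hilbert spaces\<close>

lemma cinner_add_right: "cinner x (y + z) = cinner x y + cinner x (z :: 'h::complex_hilbert_space)"
  by (metis cinner_add_left cinner_commute complex_cnj_add)

lemma cinner_scaleC_right: "cinner x (c *\<^sub>C y) = cnj c * cinner x (y :: 'h::complex_hilbert_space)"
  by (metis cinner_scaleC_left cinner_commute complex_cnj_mult)

lemma scaleC_minus1: "(-1) *\<^sub>C x = - (x :: 'h::complex_hilbert_space)"
  using scaleR_scaleC[of "-1" x] by simp

lemma scaleC_zero: "0 *\<^sub>C x = (0 :: 'h::complex_hilbert_space)"
  using scaleR_scaleC[of 0 x] by simp

lemma cinner_minus_left: "cinner (- x) y = - cinner x (y :: 'h::complex_hilbert_space)"
  using cinner_scaleC_left[of "-1" x y] by (simp add: scaleC_minus1)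

lemma cinner_minus_right: "cinner x (- y) = - cinner x (y :: 'h::complex_hilbert_space)"
  using cinner_scaleC_right[of x "-1" y] by (simp add: scaleC_minus1)

lemma cinner_diff_left: "cinner (x - y) z = cinner x z - cinner y (z :: 'h::complex_hilbert_space)"
  using cinner_add_left[of x "- y" z] by (simp add: cinner_minus_left)

lemma cinner_diff_right: "cinner x (y - z) = cinner x y - cinner x (z :: 'h::complex_hilbert_space)"
  using cinner_add_right[of x y "- z"] by (simp add: cinner_minus_right)

lemma cinner_scaleR_left: "cinner (r *\<^sub>R x) y = of_real r * cinner x (y :: 'h::complex_hilbert_space)"
  by (simp add: scaleR_scaleC cinner_scaleC_left)

lemma cinner_scaleR_right: "cinner x (r *\<^sub>R y) = of_real r * cinner x (y :: 'h::complex_hilbert_space)"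
  by (simp add: scaleR_scaleC cinner_scaleC_right)

lemmas cinner_simps = cinner_add_left cinner_add_right cinner_diff_left cinner_diff_right
  cinner_scaleC_left cinner_scaleC_right cinner_minus_left cinner_minus_right
  cinner_scaleR_left cinner_scaleR_right

lemma cinner_zero [simp]: "cinner 0 x = 0" "cinner x 0 = (0::complex)"
  for x :: "'h::complex_hilbert_space"
  using cinner_diff_left[of x x x] cinner_diff_right[of x x x] by simp_all

lemma norm_eq_sqrt_cinner: "norm x = sqrt (Re (cinner x x))" for x :: "'h::complex_hilbert_space"
  by (simp add: cinner_self flip: of_real_power)

lemma cinner_ext: "(\<And>z. cinner x z = cinner y z) \<Longrightarrow> x = y" for x y :: "'h::complex_hilbert_space"
  using cinner_diff_left[of x y "x - y"] cinner_self[of "x - y"] by simp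

lemma norm_diff_sq:
  "(norm (x - y))\<^sup>2 = (norm x)\<^sup>2 + (norm y)\<^sup>2 - 2 * Re (cinner x y)"
  for x y :: "'h::complex_hilbert_space"
proof -
  have "Re (cinner (x - y) (x - y)) = Re (cinner x x) + Re (cinner y y) - Re (cinner x y + cnj (cinner x y))"
    by (simp add: cinner_simps cinner_commute[of y x])
  then show ?thesis by (simp add: cinner_self flip: of_real_power)
qed

lemma norm_add_sq:
  "(norm (x + y))\<^sup>2 = (norm x)\<^sup>2 + (norm y)\<^sup>2 + 2 * Re (cinner x y)"
  for x y :: "'h::complex_hilbert_space"
  using norm_diff_sq[of x "- y"] by (simp add: cinner_simps)

lemma Cauchy_Schwarz: "cmod (cinner x y) \<le> norm x * norm y" for x y :: "'h::complex_hilbert_space"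
proof (cases "y = 0")
  case False
  \<comment> \<open>the coefficient of the orthogonal projection of \<open>x\<close> to \<open>y\<close>\<close>
  define c where "c = cinner x y / of_real ((norm y)\<^sup>2)"
  have "Re (cinner x (c *\<^sub>C y)) = (cmod (cinner x y))\<^sup>2 / (norm y)\<^sup>2"
    unfolding c_def cinner_scaleC_right
    by (simp add: complex_norm_square[symmetric] mult.commute flip: of_real_power of_real_divide)
  moreover have "(norm (c *\<^sub>C y))\<^sup>2 = (cmod (cinner x y))\<^sup>2 / (norm y)\<^sup>2"
    using False unfolding norm_scaleC c_def
    by (simp add: norm_divide norm_mult power2_eq_square field_simps)
  ultimately have "(cmod (cinner x y))\<^sup>2 / (norm y)\<^sup>2 \<le> (norm x)\<^sup>2"
    using norm_diff_sq[of x "c *\<^sub>C y"] by (smt (verit) zero_le_power2)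
  then have "(cmod (cinner x y))\<^sup>2 \<le> (norm x * norm y)\<^sup>2"
    using False by (simp add: field_simps power_mult_distrib)
  then show ?thesis by (rule power2_le_imp_le) simp
qed simp

lemma bounded_bilinear_cinner:
  "bounded_bilinear (cinner :: 'h::complex_hilbert_space \<Rightarrow> 'h \<Rightarrow> complex)"
  by unfold_locales
    (auto simp: cinner_simps scaleR_conv_of_real intro!: exI[of _ 1] Cauchy_Schwarz)

text \<open>The representing vector is the element \<open>v\<close> of minimal norm of the affine hyperplane \<open>f x = 1\<close>,
  rescaled.  A minimizing sequence is Cauchy by the parallelogram law, and minimality makes \<open>v\<close>
  orthogonal to the kernel of \<open>f\<close>.\<close>

lemma Riesz_representation:
  fixes f :: "'h::complex_hilbert_space \<Rightarrow> complex"
  assumes bl: "bounded_linear f" and hom: "\<And>c x. f (c *\<^sub>C x) = c * f x"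
  shows "\<exists>v. \<forall>x. f x = cinner x v"
proof (cases "\<forall>x. f x = 0")
  case True
  then show ?thesis by (intro exI[of _ 0]) simp
next
  case False
  interpret f: bounded_linear f by (rule bl)
  define S where "S = {x. f x = 1}"
  from False obtain x0 where x0: "f x0 \<noteq> 0" by blast
  have ne: "S \<noteq> {}"
    using x0 hom[of "1 / f x0" x0] unfolding S_def by auto
  define m where "m = Inf (norm ` S)"
  have m_le: "m \<le> norm x" if "x \<in> S" for x
    unfolding m_def using that by (intro cInf_lower bdd_belowI[of _ 0]) auto
  have m_ge0: "0 \<le> m"
    unfolding m_def using ne by (intro cInf_greatest) auto
  have "\<exists>x\<in>S. norm x < m + 1 / Suc n" for n
  proof -
    have "Inf (norm ` S) < m + 1 / Suc n" unfolding m_def by simp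
    then show ?thesis using ne cInf_lessD[of "norm ` S"] by blast
  qed
  then obtain y where yS: "\<And>n. y n \<in> S" and y: "\<And>n. norm (y n) < m + 1 / Suc n" by metis
  \<comment> \<open>parallelogram law, with the midpoint again in the hyperplane\<close>
  have half: "(norm (a - b))\<^sup>2 \<le> 2 * (norm a)\<^sup>2 + 2 * (norm b)\<^sup>2 - 4 * m\<^sup>2" if "a \<in> S" "b \<in> S" for a b
  proof -
    have "(1/2) *\<^sub>R (a + b) \<in> S" using that by (simp add: S_def f.scaleR f.add scaleR_conv_of_real)
    from power_mono[OF m_le[OF this] m_ge0, of 2]
    have "4 * m\<^sup>2 \<le> (norm (a + b))\<^sup>2" by (simp add: power_mult_distrib power_divide)
    then show ?thesis using norm_diff_sq[of a b] norm_add_sq[of a b] by simp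
  qed
  have "Cauchy y"
  proof (rule metric_CauchyI)
    fix e :: real assume e: "0 < e"
    have "(\<lambda>n. 4 * (m + 1 / real (Suc n))\<^sup>2 - 4 * m\<^sup>2) \<longlonglongrightarrow> 4 * (m + 0)\<^sup>2 - 4 * m\<^sup>2"
      by (intro tendsto_intros LIMSEQ_Suc[OF lim_1_over_n])
    then have "\<forall>\<^sub>F n in sequentially. 4 * (m + 1 / real (Suc n))\<^sup>2 - 4 * m\<^sup>2 < e\<^sup>2"
      using e by (intro order_tendstoD(2)[where y = 0]) auto
    then obtain N where N: "4 * (m + 1 / real (Suc N))\<^sup>2 - 4 * m\<^sup>2 < e\<^sup>2"
      unfolding eventually_sequentially by blast
    have b: "(norm (y n))\<^sup>2 \<le> (m + 1 / real (Suc N))\<^sup>2" if "n \<ge> N" for n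
    proof (rule power_mono)
      have "1 / real (Suc n) \<le> 1 / real (Suc N)" using that by (simp add: frac_le)
      then show "norm (y n) \<le> m + 1 / real (Suc N)" using y[of n] by linarith
    qed simp
    have "dist (y p) (y q) < e" if "p \<ge> N" "q \<ge> N" for p q
    proof -
      have "(norm (y p - y q))\<^sup>2 < e\<^sup>2"
        using half[OF yS yS, of p q] b[OF that(1)] b[OF that(2)] N by linarith
      then show ?thesis unfolding dist_norm using e by (simp add: power2_less_imp_less)
    qed
    then show "\<exists>M. \<forall>p\<ge>M. \<forall>q\<ge>M. dist (y p) (y q) < e" by blast
  qed
  then obtain v where v: "y \<longlonglongrightarrow> v" using Cauchy_convergent_iff convergent_def by blast
  have "(\<lambda>n. f (y n)) \<longlonglongrightarrow> f v" by (rule f.tendsto[OF v])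
  moreover have "(\<lambda>n. f (y n)) = (\<lambda>n. 1)" using yS by (simp add: S_def)
  ultimately have fv: "f v = 1" using LIMSEQ_unique[OF _ tendsto_const] by metis
  have "(\<lambda>n. norm (y n)) \<longlonglongrightarrow> norm v" by (intro tendsto_intros v)
  moreover have "(\<lambda>n. m + 1 / real (Suc n)) \<longlonglongrightarrow> m + 0"
    by (intro tendsto_intros LIMSEQ_Suc[OF lim_1_over_n])
  ultimately have "norm v \<le> m + 0"
    using y by (intro LIMSEQ_le[of "\<lambda>n. norm (y n)" _ "\<lambda>n. m + 1 / real (Suc n)"]) (auto intro!: less_imp_le)
  then have min: "norm v \<le> norm x" if "f x = 1" for x
    using m_le[of x] that unfolding S_def by simp
  have v0: "v \<noteq> 0" using fv by auto
  have orth: "cinner z v = 0" if "f z = 0" for z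
  proof (cases "z = 0")
    case False
    \<comment> \<open>moving \<open>v\<close> against its projection to \<open>z\<close> stays in the hyperplane and would shorten it\<close>
    define c where "c = cinner v z / of_real ((norm z)\<^sup>2)"
    have "f (v - c *\<^sub>C z) = 1" using that fv by (simp add: f.diff hom)
    then have le: "(norm v)\<^sup>2 \<le> (norm (v - c *\<^sub>C z))\<^sup>2" using min by (simp add: power_mono)
    have "Re (cinner v (c *\<^sub>C z)) = (cmod (cinner v z))\<^sup>2 / (norm z)\<^sup>2"
      unfolding c_def cinner_scaleC_right
      by (simp add: complex_norm_square[symmetric] mult.commute flip: of_real_power of_real_divide)
    moreover have "(norm (c *\<^sub>C z))\<^sup>2 = (cmod (cinner v z))\<^sup>2 / (norm z)\<^sup>2"
      using False unfolding norm_scaleC c_def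
      by (simp add: norm_divide norm_mult power2_eq_square field_simps)
    ultimately have "(cmod (cinner v z))\<^sup>2 / (norm z)\<^sup>2 \<le> 0"
      using norm_diff_sq[of v "c *\<^sub>C z"] le by linarith
    then have "cinner v z = 0" using False by (simp add: divide_le_0_iff)
    then show ?thesis using cinner_commute[of z v] by simp
  qed simp
  have "f x = cinner x ((1 / of_real ((norm v)\<^sup>2)) *\<^sub>C v)" for x
  proof -
    have "f (x - f x *\<^sub>C v) = 0" using fv by (simp add: f.diff hom)
    from orth[OF this] have "cinner x v = f x * of_real ((norm v)\<^sup>2)"
      by (simp add: cinner_simps cinner_self)
    then show ?thesis using v0 by (simp add: cinner_simps)
  qed
  then show ?thesis by blast
qed

lemma adjoint_exists:
  fixes T :: "'h::complex_hilbert_space \<Rightarrow>\<^sub>L 'h"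
  assumes T: "clinear_op T"
  shows "\<exists>S. is_adjoint T S"
proof -
  interpret c: bounded_bilinear "cinner :: 'h \<Rightarrow> 'h \<Rightarrow> complex" by (rule bounded_bilinear_cinner)
  have "\<exists>v. \<forall>x. cinner (T x) y = cinner x v" for y
    using T by (intro Riesz_representation
        bounded_linear_compose[OF c.bounded_linear_left blinfun.bounded_linear_right])
      (simp add: clinear_op_def cinner_simps)
  then obtain s where s: "\<And>x y. cinner (T x) y = cinner x (s y)" by metis
  have eqI: "a = b" if "\<And>x. cinner x a = cinner x b" for a b :: 'h
    using that by (metis cinner_commute cinner_ext)
  have "bounded_linear s"
  proof (rule bounded_linear_intro[where K = "norm T"])
    show "s (x + y) = s x + s y" for x y
      by (rule eqI) (simp add: cinner_simps flip: s)
    show "s (r *\<^sub>R x) = r *\<^sub>R s x" for r x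
      by (rule eqI) (simp add: cinner_simps flip: s)
    show "norm (s y) \<le> norm y * norm T" for y
    proof (cases "s y = 0")
      case False
      have "(norm (s y))\<^sup>2 = cmod (cinner (s y) (s y))" by (simp add: cinner_self norm_power)
      also have "\<dots> = cmod (cinner (T (s y)) y)" by (simp add: s)
      also have "\<dots> \<le> norm (T (s y)) * norm y" by (rule Cauchy_Schwarz)
      also have "\<dots> \<le> (norm T * norm (s y)) * norm y"
        by (intro mult_right_mono norm_blinfun) simp
      finally show ?thesis using False by (simp add: power2_eq_square mult_ac)
    qed simp
  qed
  then have "is_adjoint T (Blinfun s)"
    by (simp add: is_adjoint_def bounded_linear_Blinfun_apply s)
  then show ?thesis ..
qed

lemma is_adjoint_unique: "is_adjoint T S \<Longrightarrow> is_adjoint T S' \<Longrightarrow> S = S'"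
  for T :: "'h::complex_hilbert_space \<Rightarrow>\<^sub>L 'h"
  by (rule blinfun_eqI) (metis is_adjoint_def cinner_commute cinner_ext)

text \<open>The trace norm is defined with \<open>adj_op\<close>, a definite description.  It agrees with the norm of the
  vector \<open>x \<Omega>\<close> as soon as an adjoint exists, which is where the Riesz representation theorem is
  needed.\<close>

lemma norm2_eq:
  fixes x :: "'h::complex_hilbert_space \<Rightarrow>\<^sub>L 'h"
  assumes "clinear_op x"
  shows "norm2 \<Omega> x = norm (x \<Omega>)"
proof -
  obtain S where S: "is_adjoint x S" using adjoint_exists[OF assms] by blast
  then have "adj_op x = S" unfolding adj_op_def using is_adjoint_unique by blast
  moreover have "cinner (S (x \<Omega>)) \<Omega> = cinner (x \<Omega>) (x \<Omega>)"
    using S unfolding is_adjoint_def by (metis cinner_commute)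
  ultimately show ?thesis by (simp add: norm2_def vtrace_def norm_eq_sqrt_cinner)
qed

lemma clinear_diff: "clinear_op S \<Longrightarrow> clinear_op T \<Longrightarrow> clinear_op (S - T)"
  unfolding clinear_op_def
  by (simp add: blinfun.diff_left) (metis scaleC_add_right diff_add_cancel add_diff_cancel)

lemma scalar_op_apply: "scalar_op c x = c *\<^sub>C x"
  by (simp add: scalar_op_def bounded_linear_Blinfun_apply bounded_linear_scaleC)

lemma dense_induct [consumes 1, case_names closed dense]:
  "closure D = UNIV \<Longrightarrow> closed {x. P x} \<Longrightarrow> (\<And>x. x \<in> D \<Longrightarrow> P x) \<Longrightarrow> P x"
  by (metis UNIV_I closure_minimal mem_Collect_eq subsetD subsetI)

text \<open>This produces the unitaries of the GNS space from prescriptions on the dense set of vectors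
  \<open>\<pi> a \<Omega>\<close>: an isometry is uniformly continuous, so it extends to the closure, and algebraic
  identities survive because they are closed conditions.\<close>

lemma isometry_extension:
  fixes f :: "'h::complex_hilbert_space \<Rightarrow> 'h"
  assumes dense: "closure D = UNIV"
    and Dadd: "\<And>x y. x \<in> D \<Longrightarrow> y \<in> D \<Longrightarrow> x + y \<in> D"
    and Dscale: "\<And>c x. x \<in> D \<Longrightarrow> c *\<^sub>C x \<in> D"
    and add: "\<And>x y. x \<in> D \<Longrightarrow> y \<in> D \<Longrightarrow> f (x + y) = f x + f y"
    and scale: "\<And>c x. x \<in> D \<Longrightarrow> f (c *\<^sub>C x) = c *\<^sub>C f x"
    and iso: "\<And>x. x \<in> D \<Longrightarrow> norm (f x) = norm x"
  shows "\<exists>V :: 'h \<Rightarrow>\<^sub>L 'h. clinear_op V \<and> (\<forall>x. norm (V x) = norm x) \<and> (\<forall>x\<in>D. V x = f x)"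
proof -
  have "uniformly_continuous_on D f"
  proof -
    have "dist (f x) (f y) = dist x y" if "x \<in> D" "y \<in> D" for x y
    proof -
      have "x - y = x + (-1) *\<^sub>C y" by (simp add: scaleC_minus1)
      moreover have "f (x + (-1) *\<^sub>C y) = f x - f y"
        using that by (simp add: add Dscale scale) (simp add: scaleC_minus1)
      moreover have "x + (-1) *\<^sub>C y \<in> D" using that by (simp add: Dadd Dscale)
      ultimately show ?thesis by (metis dist_norm iso)
    qed
    then show ?thesis unfolding uniformly_continuous_on_def by metis
  qed
  then obtain g where g: "uniformly_continuous_on (closure D) g" and gD: "\<And>x. x \<in> D \<Longrightarrow> f x = g x"
    by (rule uniformly_continuous_on_extension_on_closure) blast
  then have cont: "continuous_on UNIV g" using uniformly_continuous_imp_continuous dense by metis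
  have c: "continuous_on UNIV (\<lambda>x. g (h x))" if "continuous_on UNIV h" for h :: "'h \<Rightarrow> 'h"
    using continuous_on_compose2[OF cont that] by simp
  have cs: "continuous_on UNIV (\<lambda>x. c *\<^sub>C h x)" if "continuous_on UNIV h" for h :: "'h \<Rightarrow> 'h" and c
    by (rule bounded_linear.continuous_on[OF bounded_linear_scaleC that])
  have gs: "g (c *\<^sub>C x) = c *\<^sub>C g x" for c x
    using dense by (induct x rule: dense_induct)
     (auto intro!: closed_Collect_eq c cs continuous_intros simp: scale Dscale simp flip: gD)
  have gn: "norm (g x) = norm x" for x
    using dense by (induct x rule: dense_induct)
     (auto intro!: closed_Collect_eq c cs continuous_intros simp: iso simp flip: gD)
  have ga1: "g (x + y) = g x + g y" if "x \<in> D" for x y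
    using dense by (induct y rule: dense_induct)
     (use that in \<open>auto intro!: closed_Collect_eq c cs continuous_intros simp: add Dadd simp flip: gD\<close>)
  have ga: "g (x + y) = g x + g y" for x y
    using dense by (induct x rule: dense_induct)
     (auto intro!: closed_Collect_eq c cs continuous_intros simp: ga1)
  have "bounded_linear g"
    by (rule bounded_linear_intro[where K = 1]) (simp_all add: ga scaleR_scaleC gs gn)
  then show ?thesis
    by (intro exI[of _ "Blinfun g"])
      (auto simp: bounded_linear_Blinfun_apply clinear_op_def gs gn gD)
qed

lemma isometry_cinner:
  fixes V :: "'h::complex_hilbert_space \<Rightarrow>\<^sub>L 'h"
  assumes lin: "clinear_op V" and iso: "\<And>x. norm (V x) = norm x"
  shows "cinner (V x) (V y) = cinner x y"
proof -
  have re: "Re (cinner (V x) (V y)) = Re (cinner x y)" for x y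
    using norm_diff_sq[of "V x" "V y"] norm_diff_sq[of x y] iso
    by (simp flip: blinfun.diff_right)
  have "Im (cinner a b) = Re (cinner a (\<i> *\<^sub>C b))" for a b :: 'h
    by (simp add: cinner_simps)
  moreover have "V (\<i> *\<^sub>C y) = \<i> *\<^sub>C V y" using lin by (simp add: clinear_op_def)
  ultimately show ?thesis using re by (metis complex_eqI)
qed

section \<open>The weak operator topology\<close>

lemma continuous_map_wot_coord:
  fixes x y :: "'h::complex_hilbert_space"
  shows "continuous_map weak_operator_topology euclidean (\<lambda>T. cinner (blinfun_apply T x) y)"
proof -
  have "continuous_map euclidean euclidean (\<lambda>f :: 'h \<times> 'h \<Rightarrow> complex. f (x, y))"
    by (simp add: continuous_on_product_coordinates)
  from continuous_map_pullback[OF this, of UNIV "\<lambda>T (x, y). cinner (blinfun_apply T x) y"]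
  show ?thesis by (simp add: weak_operator_topology_def o_def)
qed

lemma topspace_wot [simp]: "topspace weak_operator_topology = UNIV"
  by (simp add: weak_operator_topology_def topspace_pullback_topology)

lemma continuous_map_into_wot:
  fixes g :: "'a \<Rightarrow> ('h::complex_hilbert_space \<Rightarrow>\<^sub>L 'h)"
  assumes "\<And>x y. continuous_map X euclidean (\<lambda>a. cinner (blinfun_apply (g a) x) y)"
  shows "continuous_map X weak_operator_topology g"
  unfolding weak_operator_topology_def
proof (rule continuous_map_pullback')
  have "continuous_map X (product_topology (\<lambda>i. euclidean) UNIV)
      (\<lambda>a (x, y). cinner (blinfun_apply (g a) x) y)"
    by (subst continuous_map_componentwise_UNIV) (auto simp: assms)
  then show "continuous_map X euclidean ((\<lambda>T (x, y). cinner (blinfun_apply T x) y) \<circ> g)"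
    by (simp add: euclidean_product_topology o_def)
qed auto

text \<open>Identities between matrix coefficients pass from the dense matrix algebras to their weak
  closures by this rule.\<close>

lemma wot_closure_eqI:
  fixes f g :: "('h::complex_hilbert_space \<Rightarrow>\<^sub>L 'h) \<Rightarrow> complex"
  assumes T: "T \<in> weak_operator_topology closure_of S"
    and f: "continuous_map weak_operator_topology euclidean f"
    and g: "continuous_map weak_operator_topology euclidean g"
    and eq: "\<And>T. T \<in> S \<Longrightarrow> f T = g T"
  shows "f T = g T"
proof -
  have "closedin weak_operator_topology {T. f T = g T}"
    using closedin_continuous_map_preimage[OF continuous_map_diff[OF f g], of "{0}"] by simp
  then have "weak_operator_topology closure_of S \<subseteq> {T. f T = g T}"
    using eq by (intro closure_of_minimal) auto
  then show ?thesis using T by blast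
qed

lemma continuous_map_cmult_left:
  fixes f :: "'a \<Rightarrow> complex"
  shows "continuous_map X euclidean f \<Longrightarrow> continuous_map X euclidean (\<lambda>x. c * f x)"
  by (simp add: continuous_map_atin tendsto_mult)

section \<open>Matrix adjoints and Kronecker products\<close>

lemma index_mat_adjoint [simp]:
  fixes A :: "complex mat"
  assumes "i < dim_col A" "j < dim_row A"
  shows "mat_adjoint A $$ (i, j) = cnj (A $$ (j, i))"
  using assms by (simp add: mat_adjoint_def mat_of_rows_def)

lemma dim_mat_adjoint [simp]:
  "dim_row (mat_adjoint A) = dim_col A" "dim_col (mat_adjoint A) = dim_row (A :: complex mat)"
  by (simp_all add: mat_adjoint_def)

lemma mat_adjoint_carrier [intro, simp]:
  "A \<in> carrier_mat m n \<Longrightarrow> mat_adjoint A \<in> carrier_mat n m" for A :: "complex mat"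
  by (intro carrier_matI) simp_all

lemma mat_adjoint_mat_adjoint [simp]: "mat_adjoint (mat_adjoint A) = (A :: complex mat)"
  by (rule eq_matI) auto

lemma mat_adjoint_one [simp]: "mat_adjoint (1\<^sub>m n) = (1\<^sub>m n :: complex mat)"
  by (rule eq_matI) auto

lemma mat_adjoint_mult:
  "dim_col A = dim_row B \<Longrightarrow> mat_adjoint (A * B) = mat_adjoint B * mat_adjoint (A :: complex mat)"
  by (rule eq_matI) (auto simp: scalar_prod_def mult.commute intro!: sum.cong)

lemma dim_kron [simp]:
  "dim_row (A \<otimes>\<^sub>m B) = dim_row A * dim_row B" "dim_col (A \<otimes>\<^sub>m B) = dim_col A * dim_col B"
  by (simp_all add: kron_def)

lemma index_kron:
  "i < dim_row A * dim_row B \<Longrightarrow> j < dim_col A * dim_col B \<Longrightarrow>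
   (A \<otimes>\<^sub>m B) $$ (i, j) =
     A $$ (i div dim_row B, j div dim_col B) * B $$ (i mod dim_row B, j mod dim_col B)"
  by (simp add: kron_def)

lemma kron_carrier [intro]:
  "A \<in> carrier_mat a b \<Longrightarrow> B \<in> carrier_mat c d \<Longrightarrow> A \<otimes>\<^sub>m B \<in> carrier_mat (a * c) (b * d)"
  by (intro carrier_matI) simp_all

lemma div_mod_bounds:
  assumes "i < a * (b :: nat)"
  shows "i div b < a" "i mod b < b"
  using assms by (auto simp: less_mult_imp_div_less intro!: mod_less_divisor Nat.gr0I)

text \<open>An index of a Kronecker product is the pair of its quotient and remainder; this is the
  corresponding form of Fubini.\<close>

lemma sum_div_mod:
  "(\<Sum>k<n * m. f (k div m) (k mod m)) = (\<Sum>i<n. \<Sum>j<m. f i j)" for f :: "nat \<Rightarrow> nat \<Rightarrow> 'a::comm_monoid_add"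
proof -
  have "(\<Sum>k<n * m. f (k div m) (k mod m)) = (\<Sum>i<n. \<Sum>k=i*m..<i*m+m. f (k div m) (k mod m))"
    by (simp add: sum.nat_group)
  also have "\<dots> = (\<Sum>i<n. \<Sum>j<m. f i j)"
  proof (rule sum.cong[OF refl])
    fix i
    have "(\<Sum>k=i*m..<i*m+m. f (k div m) (k mod m)) = (\<Sum>k=0..<m. f ((k + i*m) div m) ((k + i*m) mod m))"
      using sum.shift_bounds_nat_ivl[of "\<lambda>k. f (k div m) (k mod m)" 0 "i*m" m] by (simp add: add.commute)
    also have "\<dots> = (\<Sum>j<m. f i j)" by (rule sum.cong) (auto simp: atLeast0LessThan)
    finally show "(\<Sum>k=i*m..<i*m+m. f (k div m) (k mod m)) = (\<Sum>j<m. f i j)" .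
  qed
  finally show ?thesis .
qed

lemma kron_mult:
  assumes "dim_col A = dim_row C" "dim_col B = dim_row D"
  shows "(A \<otimes>\<^sub>m B) * (C \<otimes>\<^sub>m D) = (A * C) \<otimes>\<^sub>m (B * D)"
proof (rule eq_matI)
  fix i j assume "i < dim_row ((A * C) \<otimes>\<^sub>m (B * D))" "j < dim_col ((A * C) \<otimes>\<^sub>m (B * D))"
  then have i: "i < dim_row A * dim_row B" and j: "j < dim_col C * dim_col D" by auto
  note b = div_mod_bounds[OF i] div_mod_bounds[OF j]
  let ?i = "i div dim_row B" and ?i' = "i mod dim_row B"
  let ?j = "j div dim_col D" and ?j' = "j mod dim_col D"
  have "((A \<otimes>\<^sub>m B) * (C \<otimes>\<^sub>m D)) $$ (i, j) =
      (\<Sum>k<dim_row C * dim_row D. (A \<otimes>\<^sub>m B) $$ (i, k) * (C \<otimes>\<^sub>m D) $$ (k, j))"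
    using i j assms by (simp add: scalar_prod_def atLeast0LessThan)
  also have "\<dots> = (\<Sum>k<dim_row C * dim_row D. (A $$ (?i, k div dim_row D) * C $$ (k div dim_row D, ?j)) *
      (B $$ (?i', k mod dim_row D) * D $$ (k mod dim_row D, ?j')))"
    using i j assms by (intro sum.cong) (auto simp: index_kron mult_ac)
  also have "\<dots> = (\<Sum>k<dim_row C. A $$ (?i, k) * C $$ (k, ?j)) * (\<Sum>l<dim_row D. B $$ (?i', l) * D $$ (l, ?j'))"
    by (subst sum_div_mod) (simp add: sum_product)
  also have "\<dots> = (A * C) $$ (?i, ?j) * (B * D) $$ (?i', ?j')"
    using b assms by (simp add: scalar_prod_def atLeast0LessThan)
  finally show "((A \<otimes>\<^sub>m B) * (C \<otimes>\<^sub>m D)) $$ (i, j) = ((A * C) \<otimes>\<^sub>m (B * D)) $$ (i, j)"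
    using i j by (simp add: index_kron)
qed auto

lemma kron_assoc: "(A \<otimes>\<^sub>m B) \<otimes>\<^sub>m C = A \<otimes>\<^sub>m (B \<otimes>\<^sub>m C)"
proof (rule eq_matI)
  fix i j assume "i < dim_row (A \<otimes>\<^sub>m (B \<otimes>\<^sub>m C))" "j < dim_col (A \<otimes>\<^sub>m (B \<otimes>\<^sub>m C))"
  then have i: "i < dim_row A * dim_row B * dim_row C" and j: "j < dim_col A * dim_col B * dim_col C"
    by (simp_all add: mult.assoc)
  have i': "i < dim_row A * (dim_row B * dim_row C)" and j': "j < dim_col A * (dim_col B * dim_col C)"
    using i j by (simp_all add: mult.assoc)
  have split: "x div (b * c) = x div c div b \<and> x mod (b * c) div c = x div c mod b \<and> x mod (b * c) mod c = x mod c"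
    if "x < a * (b * c)" for x a b c :: nat
  proof -
    have "0 < c" using that by (auto intro: Nat.gr0I)
    then show ?thesis using mod_mult2_eq[of x c b] by (simp add: div_mult2_eq mult.commute[of b c])
  qed
  show "((A \<otimes>\<^sub>m B) \<otimes>\<^sub>m C) $$ (i, j) = (A \<otimes>\<^sub>m (B \<otimes>\<^sub>m C)) $$ (i, j)"
    using i j i' j' split[OF i'] split[OF j'] div_mod_bounds[OF i] div_mod_bounds[OF j]
      div_mod_bounds[OF i'] div_mod_bounds[OF j']
    by (simp add: index_kron mult.assoc)
qed (simp_all add: mult.assoc)

lemma mat_adjoint_kron: "mat_adjoint (A \<otimes>\<^sub>m B) = mat_adjoint A \<otimes>\<^sub>m mat_adjoint B"
  by (rule eq_matI) (auto simp: index_kron div_mod_bounds)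

lemma kron_one_one: "1\<^sub>m m \<otimes>\<^sub>m 1\<^sub>m n = 1\<^sub>m (m * n)"
proof (rule eq_matI)
  fix i j assume "i < dim_row (1\<^sub>m (m * n))" "j < dim_col (1\<^sub>m (m * n))"
  then have "i < m * n" "j < m * n" by auto
  moreover have "i div n = j div n \<and> i mod n = j mod n \<longleftrightarrow> i = j"
    by (metis div_mult_mod_eq)
  ultimately show "(1\<^sub>m m \<otimes>\<^sub>m 1\<^sub>m n) $$ (i, j) = (1\<^sub>m (m * n)) $$ (i, j)"
    by (auto simp: index_kron div_mod_bounds)
qed auto

lemma kron_one_left [simp]: "1\<^sub>m (Suc 0) \<otimes>\<^sub>m A = A"
  by (rule eq_matI) (auto simp: index_kron)

lemma kron_one_right [simp]: "A \<otimes>\<^sub>m 1\<^sub>m (Suc 0) = A"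
  by (rule eq_matI) (auto simp: index_kron)

lemma kron_add_left:
  "A \<in> carrier_mat m n \<Longrightarrow> B \<in> carrier_mat m n \<Longrightarrow> (A + B) \<otimes>\<^sub>m C = A \<otimes>\<^sub>m C + B \<otimes>\<^sub>m C"
  by (rule eq_matI) (auto simp: index_kron div_mod_bounds algebra_simps)

lemma kron_smult_left: "(c \<cdot>\<^sub>m A) \<otimes>\<^sub>m B = c \<cdot>\<^sub>m (A \<otimes>\<^sub>m B)"
  by (rule eq_matI) (auto simp: index_kron div_mod_bounds)

lemma normalized_trace_mult_commute:
  assumes "A \<in> carrier_mat n n" "B \<in> carrier_mat n n"
  shows "normalized_trace (A * B) = normalized_trace (B * A)"
proof -
  have "(\<Sum>i<n. (A * B) $$ (i, i)) = (\<Sum>i<n. \<Sum>j<n. A $$ (i, j) * B $$ (j, i))"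
    using assms by (intro sum.cong) (auto simp: scalar_prod_def atLeast0LessThan)
  also have "\<dots> = (\<Sum>j<n. \<Sum>i<n. A $$ (i, j) * B $$ (j, i))" by (rule sum.swap)
  also have "\<dots> = (\<Sum>i<n. (B * A) $$ (i, i))"
    using assms by (intro sum.cong) (auto simp: scalar_prod_def atLeast0LessThan mult.commute)
  finally show ?thesis using assms by (simp add: normalized_trace_def)
qed

section \<open>Equatorial Pauli matrices and parity operators\<close>

text \<open>The combination \<open>cos \<alpha> X + sin \<alpha> Y\<close> of Pauli matrices.  On the Bloch sphere these half-turns have
  their axes on the equator.\<close>

definition equator :: "real \<Rightarrow> complex mat" where
  "equator \<alpha> = mat 2 2 (\<lambda>(i, j). if i = j then 0 else if i = 0 then cis (- \<alpha>) else cis \<alpha>)"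

text \<open>The Pauli matrix \<open>Z\<close>.\<close>

definition phase_flip :: "complex mat" where
  "phase_flip = mat 2 2 (\<lambda>(i, j). if i = j then (if i = 0 then 1 else -1) else 0)"

lemma equator_carrier [simp, intro]: "equator \<alpha> \<in> carrier_mat 2 2"
  and dim_equator [simp]: "dim_row (equator \<alpha>) = 2" "dim_col (equator \<alpha>) = 2"
  by (simp_all add: equator_def)

lemma phase_flip_carrier [simp, intro]: "phase_flip \<in> carrier_mat 2 2"
  and dim_phase_flip [simp]: "dim_row phase_flip = 2" "dim_col phase_flip = 2"
  by (simp_all add: phase_flip_def)

lemma sum2: "(\<Sum>k = 0..<2. f k) = f 0 + f (Suc 0)" for f :: "nat \<Rightarrow> complex"
  by (simp add: numeral_2_eq_2)

lemma mat_adjoint_equator [simp]: "mat_adjoint (equator \<alpha>) = equator \<alpha>"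
  by (rule eq_matI) (auto simp: equator_def cis_cnj)

lemma mat_adjoint_phase_flip [simp]: "mat_adjoint phase_flip = phase_flip"
  by (rule eq_matI) (auto simp: phase_flip_def)

lemma equator_mult:
  "equator \<beta> * equator \<alpha> =
     of_real (cos (\<alpha> - \<beta>)) \<cdot>\<^sub>m 1\<^sub>m 2 + (\<i> * of_real (sin (\<alpha> - \<beta>))) \<cdot>\<^sub>m phase_flip"
  by (rule eq_matI)
    (auto simp: equator_def phase_flip_def scalar_prod_def sum2 cis_mult less_2_cases_iff complex_eq_iff
      cos_diff sin_diff)

lemma equator_square [simp]: "equator \<alpha> * equator \<alpha> = 1\<^sub>m 2"
  unfolding equator_mult by (rule eq_matI) auto

lemma phase_flip_square: "phase_flip * phase_flip = 1\<^sub>m 2"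
  by (rule eq_matI) (auto simp: phase_flip_def scalar_prod_def sum2 less_2_cases_iff)

text \<open>Length \<open>k + 1\<close>; only the first site depends on the angle, because the phase of
  \<open>H\<^sub>\<alpha> = diag (1, e\<^bsup>\<i>\<alpha>\<^esup>) H\<^sub>0\<close> cancels between consecutive factors of the spin unitary except at the two
  ends.\<close>

fun parity :: "real \<Rightarrow> nat \<Rightarrow> complex mat" where
  "parity \<alpha> 0 = equator \<alpha>"
| "parity \<alpha> (Suc k) = parity \<alpha> k \<otimes>\<^sub>m equator 0"

lemma dim_parity [simp]: "dim_row (parity \<alpha> k) = 2 ^ Suc k" "dim_col (parity \<alpha> k) = 2 ^ Suc k"
  by (induct k) auto

lemma parity_carrier [simp, intro]: "parity \<alpha> k \<in> carrier_mat (2 ^ Suc k) (2 ^ Suc k)"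
  by (rule carrier_matI) simp_all

lemma mat_adjoint_parity [simp]: "mat_adjoint (parity \<alpha> k) = parity \<alpha> k"
  by (induct k) (auto simp: mat_adjoint_kron)

text \<open>The tails \<open>X \<otimes> \<dots> \<otimes> X\<close> of the two parity operators cancel.\<close>

lemma parity_mult_eq_kron: "parity \<beta> k * parity \<alpha> k = (equator \<beta> * equator \<alpha>) \<otimes>\<^sub>m 1\<^sub>m (2 ^ k)"
proof (induct k)
  case (Suc k)
  have "parity \<beta> (Suc k) * parity \<alpha> (Suc k) = (parity \<beta> k * parity \<alpha> k) \<otimes>\<^sub>m 1\<^sub>m 2"
    by (simp add: kron_mult)
  then show ?case by (simp add: Suc kron_assoc kron_one_one mult.commute)
qed simp

lemma parity_square [simp]: "parity \<alpha> k * parity \<alpha> k = 1\<^sub>m (2 ^ Suc k)"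
  by (simp add: parity_mult_eq_kron kron_one_one)

definition phase_flip_at :: "nat \<Rightarrow> complex mat" where
  "phase_flip_at k = phase_flip \<otimes>\<^sub>m 1\<^sub>m (2 ^ k)"

lemma phase_flip_at_carrier [simp, intro]: "phase_flip_at k \<in> carrier_mat (2 ^ Suc k) (2 ^ Suc k)"
  by (rule carrier_matI) (simp_all add: phase_flip_at_def)

lemma phase_flip_at_simps:
  "mat_adjoint (phase_flip_at k) = phase_flip_at k" "phase_flip_at k * phase_flip_at k = 1\<^sub>m (2 ^ Suc k)"
  by (simp_all add: phase_flip_at_def mat_adjoint_kron kron_mult phase_flip_square kron_one_one)

lemma parity_mult:
  "parity \<beta> k * parity \<alpha> k =
     of_real (cos (\<alpha> - \<beta>)) \<cdot>\<^sub>m 1\<^sub>m (2 ^ Suc k) + (\<i> * of_real (sin (\<alpha> - \<beta>))) \<cdot>\<^sub>m phase_flip_at k"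
  unfolding parity_mult_eq_kron equator_mult phase_flip_at_def
  by (subst kron_add_left[of _ 2 2]) (auto simp: kron_smult_left kron_one_one)

section \<open>Conjugation by the spin model unitaries\<close>

lemma less_4_cases: "i < 4 \<longleftrightarrow> i = 0 \<or> i = 1 \<or> i = 2 \<or> i = (3::nat)" by auto

lemma sum4: "(\<Sum>k = 0..<4. f k) = f 0 + f 1 + f 2 + f 3" for f :: "nat \<Rightarrow> complex"
  by (simp add: numeral_eq_Suc)

lemma index_hadamard2:
  "hadamard2 \<alpha> $$ (0, 0) = of_real (1 / sqrt 2)" "hadamard2 \<alpha> $$ (0, Suc 0) = of_real (1 / sqrt 2)"
  "hadamard2 \<alpha> $$ (Suc 0, 0) = of_real (1 / sqrt 2) * cis \<alpha>"
  "hadamard2 \<alpha> $$ (Suc 0, Suc 0) = - of_real (1 / sqrt 2) * cis \<alpha>"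
  "dim_row (hadamard2 \<alpha>) = 2" "dim_col (hadamard2 \<alpha>) = 2"
  by (simp_all add: hadamard2_def mat_of_rows_list_def cis_conv_exp)

lemma dim_spin_D [simp]: "dim_row (spin_D 2 u) = 4" "dim_col (spin_D 2 u) = 4"
  by (simp_all add: spin_D_def)

text \<open>The row index \<open>i mod 2\<close> of \<open>u\<close> is the second tensor factor, since \<open>spin_D\<close> pairs \<open>E\<^bsub>jj\<^esub> \<otimes> E\<^bsub>ii\<^esub>\<close>
  with the entry \<open>(i, j)\<close>.\<close>

lemma index_spin_D:
  assumes "i < 4" "j < 4"
  shows "spin_D 2 u $$ (i, j) = (if i = j then of_real (sqrt 2) * cnj (u $$ (i mod 2, i div 2)) else 0)"
  using assms
  by (auto simp: spin_D_def less_4_cases mat_unit_def index_kron lessThan_atLeast0 sum2)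

definition spin_phase :: "real \<Rightarrow> nat \<Rightarrow> nat \<Rightarrow> complex" where
  "spin_phase \<alpha> a c = (if a = 0 then 1 else if c = 0 then cis \<alpha> else - cis \<alpha>)"

text \<open>The unimodular part of the first spin unitary.  Splitting off the scalar \<open>1 / sqrt 2\<close> leaves
  entries that are products of values of \<open>cis\<close>.\<close>

definition spin_phases :: "real \<Rightarrow> complex mat" where
  "spin_phases \<alpha> = mat 4 4 (\<lambda>(i, j). if i mod 2 = j mod 2
     then spin_phase \<alpha> (i div 2) (j div 2) * cnj (spin_phase \<alpha> (j mod 2) (j div 2)) else 0)"

lemma spin_phases_carrier [simp, intro]: "spin_phases \<alpha> \<in> carrier_mat 4 4"
  and dim_spin_phases [simp]: "dim_row (spin_phases \<alpha>) = 4" "dim_col (spin_phases \<alpha>) = 4"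
  by (simp_all add: spin_phases_def)

lemma spin_u1_hadamard2: "spin_u1 2 (hadamard2 \<alpha>) = of_real (1 / sqrt 2) \<cdot>\<^sub>m spin_phases \<alpha>"
proof -
  have r: "complex_of_real (sqrt 2) * complex_of_real (sqrt 2) = 2"
    by (metis of_real_mult of_real_numeral real_sqrt_mult_self abs_numeral)
  show ?thesis
  by (rule eq_matI)
    (auto simp: spin_u1_def spin_phases_def spin_phase_def scalar_prod_def sum4 index_spin_D index_kron
      index_hadamard2 less_4_cases field_simps r)
qed

lemma spin_phases_intertwines:
  "spin_phases \<alpha> * (1\<^sub>m 2 \<otimes>\<^sub>m equator \<alpha>) = (equator \<alpha> \<otimes>\<^sub>m equator 0) * spin_phases \<alpha>"
  by (rule eq_matI)
    (auto simp: spin_phases_def spin_phase_def scalar_prod_def sum4 index_kron equator_def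
      less_4_cases cis_mult cis_cnj)

lemma spin_phases_phase_flip:
  "spin_phases \<alpha> * (1\<^sub>m 2 \<otimes>\<^sub>m phase_flip) = (1\<^sub>m 2 \<otimes>\<^sub>m phase_flip) * spin_phases \<alpha>"
  by (rule eq_matI)
    (auto simp: spin_phases_def scalar_prod_def sum4 index_kron phase_flip_def less_4_cases)

lemma spin_phases_unitary: "mat_adjoint (spin_phases \<alpha>) * spin_phases \<alpha> = 2 \<cdot>\<^sub>m 1\<^sub>m 4"
  by (rule eq_matI)
    (auto simp: spin_phases_def spin_phase_def scalar_prod_def sum4 less_4_cases cis_mult cis_cnj)

lemma spin_u1_carrier [simp, intro]: "spin_u1 2 (hadamard2 \<alpha>) \<in> carrier_mat 4 4"
  unfolding spin_u1_hadamard2 by simp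

lemma dim_spin_u1 [simp]: "dim_row (spin_u1 2 (hadamard2 \<alpha>)) = 4" "dim_col (spin_u1 2 (hadamard2 \<alpha>)) = 4"
  using spin_u1_carrier carrier_matD by blast+

lemma mat_adjoint_smult: "mat_adjoint (c \<cdot>\<^sub>m A) = cnj c \<cdot>\<^sub>m mat_adjoint A"
  by (rule eq_matI) auto

text \<open>The local form of the key identity: conjugation by the first spin unitary spreads \<open>\<sigma>\<^sub>\<alpha>\<close> from the
  second site to \<open>\<sigma>\<^sub>\<alpha> \<otimes> X\<close>.\<close>

lemma spin_u1_intertwines:
  "spin_u1 2 (hadamard2 \<alpha>) * (1\<^sub>m 2 \<otimes>\<^sub>m equator \<alpha>) = (equator \<alpha> \<otimes>\<^sub>m equator 0) * spin_u1 2 (hadamard2 \<alpha>)"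
proof -
  have "1\<^sub>m 2 \<otimes>\<^sub>m equator \<alpha> \<in> carrier_mat 4 4" "equator \<alpha> \<otimes>\<^sub>m equator 0 \<in> carrier_mat 4 4"
    by (auto intro!: carrier_matI)
  then show ?thesis
    by (simp add: spin_u1_hadamard2 mult_smult_assoc_mat[of _ 4 4 _ 4] mult_smult_distrib[of _ 4 4 _ 4]
      spin_phases_intertwines)
qed

lemma spin_u1_phase_flip:
  "spin_u1 2 (hadamard2 \<alpha>) * (1\<^sub>m 2 \<otimes>\<^sub>m phase_flip) = (1\<^sub>m 2 \<otimes>\<^sub>m phase_flip) * spin_u1 2 (hadamard2 \<alpha>)"
proof -
  have "1\<^sub>m 2 \<otimes>\<^sub>m phase_flip \<in> carrier_mat 4 4"
    by (auto intro!: carrier_matI)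
  then show ?thesis
    by (simp add: spin_u1_hadamard2 mult_smult_assoc_mat[of _ 4 4 _ 4] mult_smult_distrib[of _ 4 4 _ 4]
      spin_phases_phase_flip)
qed

lemma spin_u1_unitary:
  "mat_adjoint (spin_u1 2 (hadamard2 \<alpha>)) * spin_u1 2 (hadamard2 \<alpha>) = 1\<^sub>m 4"
proof -
  have r: "complex_of_real (1 / sqrt 2) * complex_of_real (1 / sqrt 2) * 2 = 1"
    by (simp flip: of_real_mult)
  have s: "c \<cdot>\<^sub>m (d \<cdot>\<^sub>m (e \<cdot>\<^sub>m A)) = (c * d * e) \<cdot>\<^sub>m A" for c d e :: complex and A
    by (rule eq_matI) auto
  have "mat_adjoint (spin_u1 2 (hadamard2 \<alpha>)) * spin_u1 2 (hadamard2 \<alpha>)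
    = (complex_of_real (1 / sqrt 2) * complex_of_real (1 / sqrt 2) * 2) \<cdot>\<^sub>m 1\<^sub>m 4"
    unfolding spin_u1_hadamard2 mat_adjoint_smult
    by (simp add: mult_smult_assoc_mat[of _ 4 4 _ 4] mult_smult_distrib[of _ 4 4 _ 4]
      spin_phases_unitary s del: of_real_divide)
  also have "\<dots> = 1\<^sub>m 4" unfolding r by (rule eq_matI) auto
  finally show ?thesis .
qed

text \<open>The factors of the next spin unitary are the old ones tensored with the identity on the new
  site, followed by one factor straddling the last two sites.  All later statements are
  inductions along this recursion.\<close>

lemma spin_u_Suc:
  "spin_u 2 (hadamard2 \<alpha>) (Suc k) =
     (spin_u 2 (hadamard2 \<alpha>) k \<otimes>\<^sub>m 1\<^sub>m 2) * (1\<^sub>m (2 ^ k) \<otimes>\<^sub>m spin_u1 2 (hadamard2 \<alpha>))"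
proof -
  let ?u = "spin_u1 2 (hadamard2 \<alpha>)"
  define F where "F k i = 1\<^sub>m (2 ^ i) \<otimes>\<^sub>m ?u \<otimes>\<^sub>m 1\<^sub>m (2 ^ (k - 1 - i))" for k i
  let ?y = "1\<^sub>m (2 ^ k) \<otimes>\<^sub>m ?u"
  have F_carrier: "F k i \<in> carrier_mat (2 ^ Suc k) (2 ^ Suc k)" if "i < k" for i
  proof -
    have "Suc k = i + 2 + (k - 1 - i)" using that by simp
    then have "2 ^ Suc k = (2 :: nat) ^ i * 2 ^ 2 * 2 ^ (k - 1 - i)" by (metis power_add)
    then have eq: "2 ^ i * 4 * 2 ^ (k - 1 - i) = (2 :: nat) ^ Suc k" by simp
    show ?thesis
      unfolding F_def by (rule carrier_matI; simp only: dim_kron index_one_mat dim_spin_u1 eq)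
  qed
  \<comment> \<open>the identity on the new site can be pulled out of the product of the old factors\<close>
  have fold: "foldr (*) (map (\<lambda>i. F k i \<otimes>\<^sub>m 1\<^sub>m 2) is) ?y = (foldr (*) (map (F k) is) (1\<^sub>m (2 ^ Suc k)) \<otimes>\<^sub>m 1\<^sub>m 2) * ?y
      \<and> foldr (*) (map (F k) is) (1\<^sub>m (2 ^ Suc k)) \<in> carrier_mat (2 ^ Suc k) (2 ^ Suc k)"
    if "set is \<subseteq> {..<k}" for "is"
    using that
  proof (induct "is")
    case Nil
    have "?y \<in> carrier_mat (2 ^ k * 4) (2 ^ k * 4)" by (rule kron_carrier) auto
    moreover have "2 ^ k * 4 = 2 ^ Suc k * (2::nat)" by simp
    ultimately have "?y \<in> carrier_mat (2 ^ Suc k * 2) (2 ^ Suc k * 2)" by metis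
    then have "(1\<^sub>m (2 ^ Suc k) \<otimes>\<^sub>m 1\<^sub>m 2) * ?y = ?y"
      unfolding kron_one_one by (rule left_mult_one_mat)
    then show ?case by simp
  next
    case (Cons i "is")
    let ?G = "foldr (*) (map (F k) is) (1\<^sub>m (2 ^ Suc k))"
    have IH: "foldr (*) (map (\<lambda>i. F k i \<otimes>\<^sub>m 1\<^sub>m 2) is) ?y = (?G \<otimes>\<^sub>m 1\<^sub>m 2) * ?y"
      and G: "?G \<in> carrier_mat (2 ^ Suc k) (2 ^ Suc k)" using Cons by auto
    have Fi: "F k i \<in> carrier_mat (2 ^ Suc k) (2 ^ Suc k)" using Cons F_carrier by auto
    have y: "?y \<in> carrier_mat (2 ^ Suc k * 2) (2 ^ Suc k * 2)"
      by (auto intro!: carrier_matI)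
    have "(F k i \<otimes>\<^sub>m 1\<^sub>m 2) * ((?G \<otimes>\<^sub>m 1\<^sub>m 2) * ?y) = ((F k i \<otimes>\<^sub>m 1\<^sub>m 2) * (?G \<otimes>\<^sub>m 1\<^sub>m 2)) * ?y"
      by (rule assoc_mult_mat[symmetric, OF kron_carrier kron_carrier y]) (use G Fi in auto)
    also have "(F k i \<otimes>\<^sub>m 1\<^sub>m 2) * (?G \<otimes>\<^sub>m 1\<^sub>m 2) = (F k i * ?G) \<otimes>\<^sub>m 1\<^sub>m 2"
      using G Fi by (subst kron_mult) auto
    finally show ?case using IH G Fi by simp
  qed
  have FS: "F (Suc k) i = F k i \<otimes>\<^sub>m 1\<^sub>m 2" if "i < k" for i
  proof -
    have "Suc k - 1 - i = Suc (k - 1 - i)" using that by simp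
    then show ?thesis by (simp add: F_def kron_assoc kron_one_one mult.commute)
  qed
  have yc: "?y \<in> carrier_mat (2 ^ (Suc k + 1)) (2 ^ (Suc k + 1))"
    by (auto intro!: carrier_matI)
  have "spin_u 2 (hadamard2 \<alpha>) (Suc k) = foldr (*) (map (F (Suc k)) [0..<k]) (F (Suc k) k * 1\<^sub>m (2 ^ (Suc k + 1)))"
    by (simp add: spin_u_def F_def[abs_def])
  also have "F (Suc k) k * 1\<^sub>m (2 ^ (Suc k + 1)) = ?y"
    using yc by (simp add: F_def)
  also have "map (F (Suc k)) [0..<k] = map (\<lambda>i. F k i \<otimes>\<^sub>m 1\<^sub>m 2) [0..<k]"
    using FS by simp
  also have "foldr (*) \<dots> ?y = (foldr (*) (map (F k) [0..<k]) (1\<^sub>m (2 ^ Suc k)) \<otimes>\<^sub>m 1\<^sub>m 2) * ?y"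
    using fold[of "[0..<k]", THEN conjunct1] by (simp add: lessThan_atLeast0)
  also have "foldr (*) (map (F k) [0..<k]) (1\<^sub>m (2 ^ Suc k)) = spin_u 2 (hadamard2 \<alpha>) k"
    by (simp add: spin_u_def F_def[abs_def])
  finally show ?thesis .
qed

lemma spin_u_0: "spin_u 2 u 0 = 1\<^sub>m 2"
  by (simp add: spin_u_def)

lemma dim_spin_u [simp]:
  "dim_row (spin_u 2 (hadamard2 \<alpha>) k) = 2 ^ Suc k" "dim_col (spin_u 2 (hadamard2 \<alpha>) k) = 2 ^ Suc k"
  by (induct k) (auto simp: spin_u_Suc spin_u_0)

lemma spin_u_carrier [simp, intro]:
  "spin_u 2 (hadamard2 \<alpha>) k \<in> carrier_mat (2 ^ Suc k) (2 ^ Suc k)"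
  by (rule carrier_matI) simp_all

lemma spin_u_unitary:
  "mat_adjoint (spin_u 2 (hadamard2 \<alpha>) k) * spin_u 2 (hadamard2 \<alpha>) k = 1\<^sub>m (2 ^ Suc k)"
proof (induct k)
  case 0
  show ?case by (simp add: spin_u_0)
next
  case (Suc k)
  let ?U = "spin_u 2 (hadamard2 \<alpha>) k \<otimes>\<^sub>m 1\<^sub>m 2" and ?y = "1\<^sub>m (2 ^ k) \<otimes>\<^sub>m spin_u1 2 (hadamard2 \<alpha>)"
  let ?n = "2 ^ Suc (Suc k)"
  have U: "?U \<in> carrier_mat ?n ?n" and y: "?y \<in> carrier_mat ?n ?n"
    by (auto intro!: carrier_matI)
  have "mat_adjoint (?U * ?y) * (?U * ?y) = mat_adjoint ?y * ((mat_adjoint ?U * ?U) * ?y)"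
    using U y by (simp add: mat_adjoint_mult assoc_mult_mat[of _ ?n ?n _ ?n _ ?n])
  also have "mat_adjoint ?U * ?U = 1\<^sub>m ?n"
    by (simp add: mat_adjoint_kron kron_mult Suc kron_one_one mult.commute)
  also have "mat_adjoint ?y * (1\<^sub>m ?n * ?y) = mat_adjoint ?y * ?y" using y by simp
  also have "\<dots> = 1\<^sub>m ?n"
    by (simp add: mat_adjoint_kron kron_mult spin_u1_unitary kron_one_one mult.commute)
  finally show ?case unfolding spin_u_Suc .
qed

lemma spin_u_unitary':
  "spin_u 2 (hadamard2 \<alpha>) k * mat_adjoint (spin_u 2 (hadamard2 \<alpha>) k) = 1\<^sub>m (2 ^ Suc k)"
  by (rule mat_mult_left_right_inverse[OF _ _ spin_u_unitary]) auto

text \<open>By the recursion, the new factor turns \<open>\<sigma>\<^sub>\<alpha>\<close> on the last site into \<open>\<sigma>\<^sub>\<alpha> \<otimes> X\<close> on the last two,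
  and the earlier factors then move \<open>\<sigma>\<^sub>\<alpha>\<close> on to the first site, leaving an \<open>X\<close> behind at each step.\<close>

lemma spin_u_intertwines:
  "spin_u 2 (hadamard2 \<alpha>) k * (1\<^sub>m (2 ^ k) \<otimes>\<^sub>m equator \<alpha>) = parity \<alpha> k * spin_u 2 (hadamard2 \<alpha>) k"
proof (induct k)
  case 0
  show ?case by (simp add: spin_u_0)
next
  case (Suc k)
  let ?U = "spin_u 2 (hadamard2 \<alpha>) k" and ?u = "spin_u1 2 (hadamard2 \<alpha>)"
  let ?n = "2 ^ Suc (Suc k)"
  let ?V = "?U \<otimes>\<^sub>m 1\<^sub>m 2" and ?y = "1\<^sub>m (2 ^ k) \<otimes>\<^sub>m ?u"
  let ?e = "1\<^sub>m (2 ^ k) \<otimes>\<^sub>m (1\<^sub>m 2 \<otimes>\<^sub>m equator \<alpha>)" and ?f = "(1\<^sub>m (2 ^ k) \<otimes>\<^sub>m equator \<alpha>) \<otimes>\<^sub>m equator 0"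
  have c: "?V \<in> carrier_mat ?n ?n" "?y \<in> carrier_mat ?n ?n" "?e \<in> carrier_mat ?n ?n" "?f \<in> carrier_mat ?n ?n"
    "parity \<alpha> (Suc k) \<in> carrier_mat ?n ?n"
    by (auto intro!: carrier_matI)
  have "1\<^sub>m (2 ^ Suc k) = 1\<^sub>m (2 ^ k) \<otimes>\<^sub>m 1\<^sub>m 2"
    by (simp add: kron_one_one mult.commute)
  then have "spin_u 2 (hadamard2 \<alpha>) (Suc k) * (1\<^sub>m (2 ^ Suc k) \<otimes>\<^sub>m equator \<alpha>) = (?V * ?y) * ?e"
    unfolding spin_u_Suc by (simp add: kron_assoc)
  also have "\<dots> = ?V * (?y * ?e)" using c by (simp add: assoc_mult_mat[of _ ?n ?n _ ?n _ ?n])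
  also have "?y * ?e = ?f * ?y" by (simp add: kron_mult kron_assoc spin_u1_intertwines)
  also have "?V * (?f * ?y) = (?V * ?f) * ?y" using c by (simp add: assoc_mult_mat[of _ ?n ?n _ ?n _ ?n])
  also have "?V * ?f = parity \<alpha> (Suc k) * ?V" by (simp add: kron_mult Suc)
  also have "(parity \<alpha> (Suc k) * ?V) * ?y = parity \<alpha> (Suc k) * spin_u 2 (hadamard2 \<alpha>) (Suc k)"
    unfolding spin_u_Suc using c by (simp add: assoc_mult_mat[of _ ?n ?n _ ?n _ ?n])
  finally show ?case .
qed

text \<open>Only the last factor touches the last site, and it is diagonal there.\<close>

lemma spin_u_phase_flip:
  "spin_u 2 (hadamard2 \<alpha>) k * (1\<^sub>m (2 ^ k) \<otimes>\<^sub>m phase_flip) = (1\<^sub>m (2 ^ k) \<otimes>\<^sub>m phase_flip) * spin_u 2 (hadamard2 \<alpha>) k"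
proof (cases k)
  case 0
  then show ?thesis by (simp add: spin_u_0)
next
  case (Suc m)
  let ?U = "spin_u 2 (hadamard2 \<alpha>) m" and ?u = "spin_u1 2 (hadamard2 \<alpha>)"
  let ?n = "2 ^ Suc (Suc m)"
  let ?V = "?U \<otimes>\<^sub>m 1\<^sub>m 2" and ?y = "1\<^sub>m (2 ^ m) \<otimes>\<^sub>m ?u"
  let ?e = "1\<^sub>m (2 ^ m) \<otimes>\<^sub>m (1\<^sub>m 2 \<otimes>\<^sub>m phase_flip)"
  have c: "?V \<in> carrier_mat ?n ?n" "?y \<in> carrier_mat ?n ?n" "?e \<in> carrier_mat ?n ?n"
    by (auto intro!: carrier_matI)
  have one: "1\<^sub>m (2 ^ Suc m) = 1\<^sub>m (2 ^ m) \<otimes>\<^sub>m 1\<^sub>m 2"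
    by (simp add: kron_one_one mult.commute)
  then have e: "1\<^sub>m (2 ^ Suc m) \<otimes>\<^sub>m phase_flip = ?e" by (simp add: kron_assoc)
  have "(?V * ?y) * ?e = ?V * (?y * ?e)" using c by (simp add: assoc_mult_mat[of _ ?n ?n _ ?n _ ?n])
  also have "?y * ?e = ?e * ?y" by (simp add: kron_mult spin_u1_phase_flip)
  also have "?V * (?e * ?y) = (?V * ?e) * ?y" using c by (simp add: assoc_mult_mat[of _ ?n ?n _ ?n _ ?n])
  also have "?V * ?e = ?e * ?V" by (simp add: kron_mult flip: e)
  also have "(?e * ?V) * ?y = ?e * (?V * ?y)" using c by (simp add: assoc_mult_mat[of _ ?n ?n _ ?n _ ?n])
  finally show ?thesis unfolding Suc spin_u_Suc e .
qed

text \<open>\<open>Z\<close> and \<open>\<sigma>\<^sub>\<alpha>\<close> have only scalars as common commutant.  Commuting with \<open>Z\<close> kills the off-diagonal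
  blocks for the last site, commuting with \<open>\<sigma>\<^sub>\<alpha>\<close> identifies the two diagonal ones.\<close>

lemma commutant_last_site:
  assumes y: "y \<in> carrier_mat (N * 2) (N * 2)"
    and z: "y * (1\<^sub>m N \<otimes>\<^sub>m phase_flip) = (1\<^sub>m N \<otimes>\<^sub>m phase_flip) * y"
    and e: "y * (1\<^sub>m N \<otimes>\<^sub>m equator \<alpha>) = (1\<^sub>m N \<otimes>\<^sub>m equator \<alpha>) * y"
  shows "\<exists>x\<in>carrier_mat N N. y = x \<otimes>\<^sub>m 1\<^sub>m 2"
proof -
  have R: "(y * (1\<^sub>m N \<otimes>\<^sub>m g)) $$ (p, q) = y $$ (p, 2 * (q div 2)) * g $$ (0, q mod 2) + y $$ (p, Suc (2 * (q div 2))) * g $$ (1, q mod 2)"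
    (is "?l = ?r")
    if "p < N * 2" "q < N * 2" "g \<in> carrier_mat 2 2" for p q g
  proof -
    define F where "F a b = y $$ (p, a * 2 + b) * ((if a = q div 2 then 1 else 0) * g $$ (b, q mod 2))" for a b
    have "?l = (\<Sum>k<N * 2. y $$ (p, k) * (1\<^sub>m N \<otimes>\<^sub>m g) $$ (k, q))"
      using that y by (simp add: scalar_prod_def atLeast0LessThan)
    also have "\<dots> = (\<Sum>k<N * 2. F (k div 2) (k mod 2))"
      unfolding F_def using that by (intro sum.cong) (auto simp: index_kron less_mult_imp_div_less)
    also have "\<dots> = (\<Sum>a<N. \<Sum>b<2. F a b)" by (rule sum_div_mod)
    also have "\<dots> = (\<Sum>a<N. if a = q div 2 then ?r else 0)"
      by (intro sum.cong) (auto simp: F_def lessThan_atLeast0 sum2 mult.commute)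
    also have "\<dots> = ?r" using div_mod_bounds(1)[OF that(2)] by simp
    finally show ?thesis .
  qed
  have L: "((1\<^sub>m N \<otimes>\<^sub>m g) * y) $$ (p, q) = g $$ (p mod 2, 0) * y $$ (2 * (p div 2), q) + g $$ (p mod 2, 1) * y $$ (Suc (2 * (p div 2)), q)"
    (is "?l = ?r")
    if "p < N * 2" "q < N * 2" "g \<in> carrier_mat 2 2" for p q g
  proof -
    define F where "F a b = ((if a = p div 2 then 1 else 0) * g $$ (p mod 2, b)) * y $$ (a * 2 + b, q)" for a b
    have "?l = (\<Sum>k<N * 2. (1\<^sub>m N \<otimes>\<^sub>m g) $$ (p, k) * y $$ (k, q))"
      using that y by (simp add: scalar_prod_def atLeast0LessThan)
    also have "\<dots> = (\<Sum>k<N * 2. F (k div 2) (k mod 2))"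
      unfolding F_def using that by (intro sum.cong) (auto simp: index_kron less_mult_imp_div_less)
    also have "\<dots> = (\<Sum>a<N. \<Sum>b<2. F a b)" by (rule sum_div_mod)
    also have "\<dots> = (\<Sum>a<N. if a = p div 2 then ?r else 0)"
      by (intro sum.cong) (auto simp: F_def lessThan_atLeast0 sum2 mult.commute)
    also have "\<dots> = ?r" using div_mod_bounds(1)[OF that(1)] by simp
    finally show ?thesis .
  qed
  have lt: "2 * i < N * 2" "Suc (2 * i) < N * 2" if "i < N" for i using that by auto
  have Zi: "phase_flip $$ (0,0) = 1" "phase_flip $$ (0,1) = 0" "phase_flip $$ (1,0) = 0" "phase_flip $$ (1,1) = -1"
    by (auto simp: phase_flip_def)
  have Ei: "equator \<alpha> $$ (0,0) = 0" "equator \<alpha> $$ (0,1) = cis (-\<alpha>)" "equator \<alpha> $$ (1,0) = cis \<alpha>" "equator \<alpha> $$ (1,1) = 0"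
    by (auto simp: equator_def)
  have ze: "y $$ (2 * i, Suc (2 * j)) = 0" "y $$ (Suc (2 * i), 2 * j) = 0"
    and eq: "y $$ (Suc (2 * i), Suc (2 * j)) = y $$ (2 * i, 2 * j)" if "i < N" "j < N" for i j
  proof -
    note b = lt[OF that(1)] lt[OF that(2)]
    show "y $$ (2 * i, Suc (2 * j)) = 0"
      using arg_cong[OF z, of "\<lambda>m. m $$ (2 * i, Suc (2 * j))"] b
      by (simp add: L R Zi[unfolded One_nat_def] del: index_mult_mat)
    show "y $$ (Suc (2 * i), 2 * j) = 0"
      using arg_cong[OF z, of "\<lambda>m. m $$ (Suc (2 * i), 2 * j)"] b
      by (simp add: L R Zi[unfolded One_nat_def] del: index_mult_mat)
    show "y $$ (Suc (2 * i), Suc (2 * j)) = y $$ (2 * i, 2 * j)"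
      using arg_cong[OF e, of "\<lambda>m. m $$ (2 * i, Suc (2 * j))"] b
      by (simp add: L R Ei[unfolded One_nat_def] mult.commute[of "cis (- \<alpha>)"] del: index_mult_mat)
  qed
  define x where "x = mat N N (\<lambda>(i, j). y $$ (2 * i, 2 * j))"
  have "y = x \<otimes>\<^sub>m 1\<^sub>m 2"
  proof (rule eq_matI)
    fix p q assume "p < dim_row (x \<otimes>\<^sub>m 1\<^sub>m 2)" "q < dim_col (x \<otimes>\<^sub>m 1\<^sub>m 2)"
    then have pq: "p < N * 2" "q < N * 2" by (auto simp: x_def)
    define i j where "i = p div 2" and "j = q div 2"
    have ij: "i < N" "j < N" using pq by (auto simp: i_def j_def)
    have p: "p = 2 * i \<or> p = Suc (2 * i)" and q: "q = 2 * j \<or> q = Suc (2 * j)"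
      unfolding i_def j_def by presburger+
    show "y $$ (p, q) = (x \<otimes>\<^sub>m 1\<^sub>m 2) $$ (p, q)"
      using p q ij pq by (auto simp: index_kron x_def ze eq)
  qed (use y in \<open>auto simp: x_def\<close>)
  then show ?thesis by (intro bexI[of _ x]) (auto simp: x_def)
qed

text \<open>Conjugate the trivial relation that \<open>x \<otimes> 1\<close> commutes with \<open>1 \<otimes> \<sigma>\<^sub>\<alpha>\<close>.\<close>

lemma spin_generator_commutes_parity:
  fixes \<alpha> :: real
  assumes x: "x \<in> carrier_mat (2 ^ k) (2 ^ k)"
  defines "y \<equiv> spin_u 2 (hadamard2 \<alpha>) k * (x \<otimes>\<^sub>m 1\<^sub>m 2) * mat_adjoint (spin_u 2 (hadamard2 \<alpha>) k)"
  shows "parity \<alpha> k * y = y * parity \<alpha> k"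
proof -
  let ?n = "2 ^ Suc k"
  let ?U = "spin_u 2 (hadamard2 \<alpha>) k" and ?e = "1\<^sub>m (2 ^ k) \<otimes>\<^sub>m equator \<alpha>" and ?x = "x \<otimes>\<^sub>m 1\<^sub>m 2"
  define U' where "U' = mat_adjoint ?U"
  have c: "?U \<in> carrier_mat ?n ?n" "?e \<in> carrier_mat ?n ?n" "?x \<in> carrier_mat ?n ?n" "U' \<in> carrier_mat ?n ?n"
    "parity \<alpha> k \<in> carrier_mat ?n ?n"
    using x by (auto simp: U'_def intro!: carrier_matI)
  note as = assoc_mult_mat[of _ ?n ?n _ ?n _ ?n]
  have ex: "?e * ?x = ?x * ?e" using x by (simp add: kron_mult)
  have adj: "?e * U' = U' * parity \<alpha> k"
    using arg_cong[OF spin_u_intertwines[of \<alpha> k], of mat_adjoint]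
    by (simp add: U'_def mat_adjoint_mult mat_adjoint_kron)
  have "parity \<alpha> k * y = (parity \<alpha> k * ?U) * ?x * U'" unfolding y_def U'_def[symmetric] using c by (simp add: as)
  also have "\<dots> = ?U * (?e * ?x) * U'" using c by (simp add: as flip: spin_u_intertwines)
  also have "\<dots> = ?U * ?x * (?e * U')" unfolding ex using c by (simp add: as)
  also have "\<dots> = y * parity \<alpha> k" unfolding adj y_def U'_def[symmetric] using c by (simp add: as)
  finally show ?thesis .
qed

text \<open>One more site is needed: \<open>y \<otimes> 1\<close> commutes with \<open>Z\<close> on the new site as well as with the longer
  parity operator.  Undoing the conjugation gives a matrix commuting with \<open>Z\<close> and \<open>\<sigma>\<^sub>\<alpha>\<close> on the last
  site, hence one of the form \<open>x \<otimes> 1\<close>.\<close>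

lemma parity_commutant_is_spin_generator:
  assumes y: "y \<in> carrier_mat (2 ^ Suc k) (2 ^ Suc k)" and comm: "parity \<alpha> k * y = y * parity \<alpha> k"
  shows "\<exists>x\<in>carrier_mat (2 ^ Suc k) (2 ^ Suc k).
    y \<otimes>\<^sub>m 1\<^sub>m 2 = spin_u 2 (hadamard2 \<alpha>) (Suc k) * (x \<otimes>\<^sub>m 1\<^sub>m 2) * mat_adjoint (spin_u 2 (hadamard2 \<alpha>) (Suc k))"
proof -
  let ?n = "2 ^ Suc (Suc k)"
  let ?U = "spin_u 2 (hadamard2 \<alpha>) (Suc k)" and ?e = "1\<^sub>m (2 ^ Suc k) \<otimes>\<^sub>m equator \<alpha>" 
  let ?z = "1\<^sub>m (2 ^ Suc k) \<otimes>\<^sub>m phase_flip" and ?y = "y \<otimes>\<^sub>m 1\<^sub>m 2" and ?W = "parity \<alpha> (Suc k)"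
  define U' where "U' = mat_adjoint ?U"
  have c: "?U \<in> carrier_mat ?n ?n" "?e \<in> carrier_mat ?n ?n" "?z \<in> carrier_mat ?n ?n" "?y \<in> carrier_mat ?n ?n"
    "U' \<in> carrier_mat ?n ?n" "?W \<in> carrier_mat ?n ?n"
    using y by (auto simp: U'_def intro!: carrier_matI)
  note as = assoc_mult_mat[of _ ?n ?n _ ?n _ ?n]
  have adj: "?e * U' = U' * ?W"
    using arg_cong[OF spin_u_intertwines[of \<alpha> "Suc k"], of mat_adjoint]
    by (simp add: U'_def mat_adjoint_mult mat_adjoint_kron del: parity.simps)
  have adjz: "?z * U' = U' * ?z"
    using arg_cong[OF spin_u_phase_flip[of \<alpha> "Suc k"], of mat_adjoint]
    by (simp add: U'_def mat_adjoint_mult mat_adjoint_kron)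
  have Wy: "?W * ?y = ?y * ?W" using y comm by (simp add: kron_mult)
  have zy: "?z * ?y = ?y * ?z" using y by (simp add: kron_mult)
  \<comment> \<open>the conjugation undone\<close>
  define v where "v = U' * ?y * ?U"
  have vc: "v \<in> carrier_mat ?n ?n" unfolding v_def using c by auto
  have "v * ?e = U' * ?y * (?U * ?e)" unfolding v_def using c by (simp add: as)
  also have "\<dots> = U' * (?y * ?W) * ?U" unfolding spin_u_intertwines using c by (simp add: as)
  also have "\<dots> = (U' * ?W) * ?y * ?U" unfolding Wy[symmetric] using c by (simp add: as)
  also have "\<dots> = ?e * v" unfolding v_def adj[symmetric] using c by (simp add: as)
  finally have ve: "v * ?e = ?e * v" .
  have "v * ?z = U' * ?y * (?U * ?z)" unfolding v_def using c by (simp add: as)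
  also have "\<dots> = U' * (?y * ?z) * ?U" unfolding spin_u_phase_flip using c by (simp add: as)
  also have "\<dots> = (U' * ?z) * ?y * ?U" unfolding zy[symmetric] using c by (simp add: as)
  also have "\<dots> = ?z * v" unfolding v_def adjz[symmetric] using c by (simp add: as)
  finally have vz: "v * ?z = ?z * v" .
  obtain x where x: "x \<in> carrier_mat (2 ^ Suc k) (2 ^ Suc k)" and vx: "v = x \<otimes>\<^sub>m 1\<^sub>m 2"
    using commutant_last_site[OF _ vz ve] vc by (auto simp: mult.commute)
  have "?U * v * U' = (?U * U') * ?y * (?U * U')" unfolding v_def using c by (simp add: as)
  also have "\<dots> = ?y" unfolding U'_def spin_u_unitary' by (simp only: left_mult_one_mat[OF c(4)] right_mult_one_mat[OF c(4)])
  finally show ?thesis unfolding U'_def using x vx by metis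
qed

lemma parity_conj_Suc:
  assumes "a \<in> carrier_mat (2 ^ Suc k) (2 ^ Suc k)"
  shows "parity \<alpha> (Suc k) * (a \<otimes>\<^sub>m 1\<^sub>m 2) * parity \<alpha> (Suc k) = (parity \<alpha> k * a * parity \<alpha> k) \<otimes>\<^sub>m 1\<^sub>m 2"
  using assms by (simp add: kron_mult)

section \<open>The period-two automorphisms of the tensor powers\<close>

abbreviation "level k \<equiv> carrier_mat (2 ^ k) (2 ^ k) :: complex mat set"

text \<open>The automorphism \<open>\<theta>\<^sub>\<alpha>\<close> on \<open>k + 1\<close> sites; parity operators are self-inverse.\<close>

definition reflect :: "real \<Rightarrow> nat \<Rightarrow> complex mat \<Rightarrow> complex mat" where
  "reflect \<alpha> k a = parity \<alpha> k * a * parity \<alpha> k"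

lemma reflect_carrier [simp, intro]: "a \<in> level (Suc k) \<Longrightarrow> reflect \<alpha> k a \<in> level (Suc k)"
  unfolding reflect_def by (intro mult_carrier_mat) auto

lemma reflect_add:
  assumes "a \<in> level (Suc k)" "b \<in> level (Suc k)"
  shows "reflect \<alpha> k (a + b) = reflect \<alpha> k a + reflect \<alpha> k b"
  unfolding reflect_def mult_add_distrib_mat[OF parity_carrier assms]
  by (rule add_mult_distrib_mat[OF mult_carrier_mat[OF parity_carrier assms(1)]
        mult_carrier_mat[OF parity_carrier assms(2)] parity_carrier])

lemma reflect_smult:
  assumes "a \<in> level (Suc k)"
  shows "reflect \<alpha> k (c \<cdot>\<^sub>m a) = c \<cdot>\<^sub>m reflect \<alpha> k a"
  unfolding reflect_def mult_smult_distrib[OF parity_carrier assms]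
  by (rule mult_smult_assoc_mat[OF mult_carrier_mat[OF parity_carrier assms] parity_carrier])

lemma reflect_one: "reflect \<alpha> k (1\<^sub>m (2 ^ Suc k)) = 1\<^sub>m (2 ^ Suc k)"
  unfolding reflect_def right_mult_one_mat[OF parity_carrier] parity_square ..

lemma reflect_mult:
  assumes a: "a \<in> level (Suc k)" and b: "b \<in> level (Suc k)"
  shows "reflect \<alpha> k (a * b) = reflect \<alpha> k a * reflect \<alpha> k b"
proof -
  have gen: "W * (a * b) * W = (W * a * W) * (W * b * W)"
    if "W \<in> carrier_mat n n" "a \<in> carrier_mat n n" "b \<in> carrier_mat n n" "W * W = 1\<^sub>m n"
    for W a b :: "complex mat" and n
  proof -
    note as = assoc_mult_mat[of _ n n _ n _ n]
    have "(W * a * W) * (W * b * W) = W * a * (W * W) * b * W" using that(1-3) by (simp add: as)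
    also have "W * a * (W * W) = W * a" using that by simp
    also have "W * a * b * W = W * (a * b) * W" using that(1-3) by (simp add: as)
    finally show ?thesis by simp
  qed
  show ?thesis unfolding reflect_def by (rule gen[OF parity_carrier a b parity_square])
qed

lemma reflect_reflect:
  assumes a: "a \<in> level (Suc k)"
  shows "reflect \<beta> k (reflect \<alpha> k a) = (parity \<beta> k * parity \<alpha> k) * a * (parity \<alpha> k * parity \<beta> k)"
proof -
  have gen: "W * (X * a * X) * W = (W * X) * a * (X * W)"
    if "W \<in> carrier_mat n n" "X \<in> carrier_mat n n" "a \<in> carrier_mat n n"
    for W X a :: "complex mat" and n
    using that by (simp add: assoc_mult_mat[of _ n n _ n _ n])
  show ?thesis unfolding reflect_def by (rule gen[OF parity_carrier parity_carrier a])
qed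

lemma reflect_involution [simp]: "a \<in> level (Suc k) \<Longrightarrow> reflect \<alpha> k (reflect \<alpha> k a) = a"
  unfolding reflect_reflect parity_square
  by (simp only: left_mult_one_mat[of a "2 ^ Suc k"] right_mult_one_mat[of a _ "2 ^ Suc k"])

lemma reflect_fixed_iff:
  assumes a: "a \<in> level (Suc k)"
  shows "reflect \<alpha> k a = a \<longleftrightarrow> parity \<alpha> k * a = a * parity \<alpha> k"
proof -
  have gen: "W * a * W = a \<longleftrightarrow> W * a = a * W"
    if "W \<in> carrier_mat n n" "a \<in> carrier_mat n n" "W * W = 1\<^sub>m n"
    for W a :: "complex mat" and n
  proof -
    have "(W * a * W) * W = W * a" "(a * W) * W = a"
      using that by (simp_all add: assoc_mult_mat[of _ n n _ n _ n])
    then show ?thesis by metis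
  qed
  show ?thesis unfolding reflect_def by (rule gen[OF parity_carrier a parity_square])
qed

lemma reflect_Suc:
  "a \<in> level (Suc k) \<Longrightarrow> reflect \<alpha> (Suc k) (a \<otimes>\<^sub>m 1\<^sub>m 2) = reflect \<alpha> k a \<otimes>\<^sub>m 1\<^sub>m 2"
  unfolding reflect_def by (rule parity_conj_Suc)

text \<open>A half-turn about the axis at angle \<open>\<beta>\<close> reflects the equator of the Bloch sphere in that axis.\<close>

lemma reflect_equator: "reflect \<beta> 0 (equator \<delta>) = equator (2 * \<beta> - \<delta>)"
proof -
  have "equator \<beta> * equator \<delta> * equator \<beta> = equator (2 * \<beta> - \<delta>)"
    by (rule eq_matI)
      (auto simp: equator_def scalar_prod_def sum2 cis_mult less_2_cases_iff algebra_simps)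
  then show ?thesis by (simp add: reflect_def)
qed

text \<open>If the cosine vanishes, the two parity operators anticommute, and the sign disappears in the
  conjugation.\<close>

lemma reflect_commute:
  assumes a: "a \<in> level (Suc k)" and cos: "cos (\<alpha> - \<beta>) = 0"
  shows "reflect \<alpha> k (reflect \<beta> k a) = reflect \<beta> k (reflect \<alpha> k a)"
proof -
  let ?n = "2 ^ Suc k"
  let ?X = "parity \<alpha> k * parity \<beta> k" and ?Y = "parity \<beta> k * parity \<alpha> k"
  have sin: "sin (\<beta> - \<alpha>) = - sin (\<alpha> - \<beta>)" by (metis minus_diff_eq sin_minus)
  have cos': "cos (\<beta> - \<alpha>) = 0" using cos by (metis minus_diff_eq cos_minus)
  have XY: "?X = (-1) \<cdot>\<^sub>m ?Y"
    unfolding parity_mult cos cos' sin using phase_flip_at_carrier[of k] by (intro eq_matI) auto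
  have gen: "((-1) \<cdot>\<^sub>m Y) * a * Y = Y * a * ((-1) \<cdot>\<^sub>m Y)"
    if "Y \<in> carrier_mat n n" "a \<in> carrier_mat n n" for Y a :: "complex mat" and n
    using that mult_smult_assoc_mat[of Y n n a n] mult_smult_assoc_mat[of "Y * a" n n Y n]
      mult_smult_distrib[of "Y * a" n n Y n] by simp
  show ?thesis
    unfolding reflect_reflect[OF a] XY
    by (rule gen[OF mult_carrier_mat[OF parity_carrier parity_carrier] a])
qed

text \<open>The linear relation between three vectors on a circle.\<close>

lemma equator_combination:
  "of_real (sin (\<beta> - \<alpha>)) \<cdot>\<^sub>m equator t =
     of_real (sin (\<beta> - t)) \<cdot>\<^sub>m equator \<alpha> + of_real (sin (t - \<alpha>)) \<cdot>\<^sub>m equator \<beta>"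
  by (rule eq_matI) (auto simp: equator_def complex_eq_iff sin_diff algebra_simps)

section \<open>Unitary implementation in the GNS representation\<close>

locale gns =
  fixes \<pi> :: "complex mat \<Rightarrow> ('h::complex_hilbert_space \<Rightarrow>\<^sub>L 'h)" and \<Omega> :: 'h
  assumes gns: "gns_trace 2 \<pi> \<Omega>"
begin

lemma
  assumes a: "a \<in> level k"
  shows rep_clinear: "clinear_op (\<pi> a)"
    and rep_kron: "\<pi> (a \<otimes>\<^sub>m 1\<^sub>m 2) = \<pi> a"
    and rep_adjoint: "is_adjoint (\<pi> a) (\<pi> (mat_adjoint a))"
    and rep_smult: "\<pi> (c \<cdot>\<^sub>m a) = scalar_op c o\<^sub>L \<pi> a"
    and rep_add: "b \<in> level k \<Longrightarrow> \<pi> (a + b) = \<pi> a + \<pi> b"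
    and rep_mult: "b \<in> level k \<Longrightarrow> \<pi> (a * b) = \<pi> a o\<^sub>L \<pi> b"
    and rep_trace: "cinner (\<pi> a \<Omega>) \<Omega> = normalized_trace a"
  using gns a unfolding gns_trace_def by blast+

lemma rep_diff:
  assumes "a \<in> level k" "b \<in> level k"
  shows "\<pi> (a - b) = \<pi> a - \<pi> b"
proof -
  have "a - b = a + (-1) \<cdot>\<^sub>m b" using assms by (intro eq_matI) auto
  moreover have "\<pi> ((-1) \<cdot>\<^sub>m b) = - \<pi> b"
    by (rule blinfun_eqI) (simp add: rep_smult[OF assms(2)] scalar_op_apply scaleC_minus1 blinfun.minus_left)
  ultimately show ?thesis using rep_add[OF assms(1), of "(-1) \<cdot>\<^sub>m b"] assms by simp
qed

lemma kron_level [intro]: "a \<in> level k \<Longrightarrow> a \<otimes>\<^sub>m 1\<^sub>m 2 \<in> level (Suc k)"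
  by (rule carrier_matI) simp_all

text \<open>Matrices on different numbers of sites are compared by moving both to a common level.  The
  automorphisms are compatible with this because \<open>X\<close> is self-inverse.\<close>

lemma rep_raise:
  assumes "a \<in> level (Suc k)" "k \<le> K"
  shows "\<exists>b\<in>level (Suc K). \<pi> b = \<pi> a \<and> (\<forall>\<alpha>. \<pi> (reflect \<alpha> K b) = \<pi> (reflect \<alpha> k a))"
  using assms(2)
proof (induct K rule: dec_induct)
  case base
  then show ?case using assms by blast
next
  case (step K)
  then obtain b where b: "b \<in> level (Suc K)" "\<pi> b = \<pi> a" "\<And>\<alpha>. \<pi> (reflect \<alpha> K b) = \<pi> (reflect \<alpha> k a)"
    by blast
  show ?case
    using kron_level[OF b(1)] rep_kron[OF b(1)] reflect_Suc[OF b(1)]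
      rep_kron[OF reflect_carrier[OF b(1)]] b(2,3)
    by (intro bexI[of _ "b \<otimes>\<^sub>m 1\<^sub>m 2"]) (auto simp del: power_Suc)
qed

lemma rep_raise2:
  assumes "a \<in> level (Suc k)" "b \<in> level (Suc l)"
  obtains K a' b' where "a' \<in> level (Suc K)" "b' \<in> level (Suc K)" "\<pi> a' = \<pi> a" "\<pi> b' = \<pi> b"
    "\<And>\<alpha>. \<pi> (reflect \<alpha> K a') = \<pi> (reflect \<alpha> k a)" "\<And>\<alpha>. \<pi> (reflect \<alpha> K b') = \<pi> (reflect \<alpha> l b)"
  using rep_raise[OF assms(1) max.cobounded1[of k l]] rep_raise[OF assms(2) max.cobounded2[of l k]] that
  by blast

lemma rep_level_Suc: "a \<in> level k \<Longrightarrow> \<exists>b\<in>level (Suc k). \<pi> b = \<pi> a"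
  using rep_kron kron_level by blast

definition dense_vectors :: "'h set" where
  "dense_vectors = {\<pi> a \<Omega> | a k. a \<in> level (Suc k)}"

lemma dense_vectors_dense: "closure dense_vectors = UNIV"
proof -
  have "dense_vectors = {\<pi> a \<Omega> | a k. a \<in> level k}"
  proof (rule Set.set_eqI)
    fix x
    have "x \<in> dense_vectors" if x: "x = \<pi> a \<Omega>" and a: "a \<in> level k" for a k
    proof -
      obtain b where "b \<in> level (Suc k)" "\<pi> b = \<pi> a" using rep_level_Suc[OF a] by blast
      then have "x = \<pi> b \<Omega> \<and> b \<in> level (Suc k)" using x by simp
      then show ?thesis unfolding dense_vectors_def by blast
    qed
    then show "x \<in> dense_vectors \<longleftrightarrow> x \<in> {\<pi> a \<Omega> | a k. a \<in> level k}"
      unfolding dense_vectors_def by blast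
  qed
  moreover have "closure {\<pi> a \<Omega> | a k. a \<in> level k} = UNIV"
    using gns unfolding gns_trace_def by (rule conjunct2)
  ultimately show ?thesis by simp
qed

lemma rep_one: "\<pi> (1\<^sub>m (2 ^ Suc k)) = id_blinfun"
proof (rule blinfun_eqI)
  fix x
  show "\<pi> (1\<^sub>m (2 ^ Suc k)) x = id_blinfun x"
    using dense_vectors_dense
  proof (induct x rule: dense_induct)
    case closed
    show ?case by (intro closed_Collect_eq continuous_intros)
  next
    case (dense x)
    then obtain a l where a: "a \<in> level (Suc l)" and x: "x = \<pi> a \<Omega>" unfolding dense_vectors_def by blast
    have one: "\<pi> (1\<^sub>m (2 ^ Suc k)) = \<pi> (1\<^sub>m (2 ^ Suc (k + m)))" for m
    proof (induct m)
      case (Suc m)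
      then show ?case
        using rep_kron[of "1\<^sub>m (2 ^ Suc (k + m))" "Suc (k + m)"] kron_one_one[of "2 ^ Suc (k + m)" 2]
        by (simp add: mult.commute)
    qed simp
    obtain c' where c': "c' \<in> level (Suc (k + l))" "\<pi> c' = \<pi> a"
      using rep_raise[OF a, of "k + l"] by auto
    have "\<pi> (1\<^sub>m (2 ^ Suc (k + l)) * c') = \<pi> (1\<^sub>m (2 ^ Suc (k + l))) o\<^sub>L \<pi> c'"
      by (rule rep_mult[OF one_carrier_mat c'(1)])
    then show ?case
      unfolding left_mult_one_mat[OF c'(1)] using one[of l] c'(2) x
      by (metis blinfun_apply_blinfun_compose blinfun_apply_id_blinfun id_apply)
  qed
qed

lemma cinner_rep:
  assumes "a \<in> level k" "b \<in> level k"
  shows "cinner (\<pi> a \<Omega>) (\<pi> b \<Omega>) = normalized_trace (mat_adjoint b * a)"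
proof -
  have b': "mat_adjoint b \<in> level k" using assms by simp
  have "cinner (\<pi> a \<Omega>) (\<pi> b \<Omega>) = cinner (\<pi> (mat_adjoint b) (\<pi> a \<Omega>)) \<Omega>"
    using rep_adjoint[OF b'] by (simp add: is_adjoint_def)
  also have "\<dots> = cinner (\<pi> (mat_adjoint b * a) \<Omega>) \<Omega>"
    by (simp add: rep_mult[OF b' assms(1)])
  also have "\<dots> = normalized_trace (mat_adjoint b * a)"
    by (rule rep_trace[OF mult_carrier_mat[OF b' assms(1)]])
  finally show ?thesis .
qed

lemma norm_rep:
  "a \<in> level k \<Longrightarrow> norm (\<pi> a \<Omega>) = sqrt (Re (normalized_trace (mat_adjoint a * a)))"
  by (simp add: norm_eq_sqrt_cinner cinner_rep)

lemma norm_\<Omega>: "norm \<Omega> = 1"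
proof -
  have "norm \<Omega> = sqrt (Re (normalized_trace (1\<^sub>m (2 ^ Suc 0))))"
    using norm_rep[of "1\<^sub>m (2 ^ Suc 0)" "Suc 0"] by (simp add: rep_one[of 0, simplified])
  then show ?thesis by (simp add: normalized_trace_def)
qed

lemma norm_rep_unitary_left:
  assumes a: "a \<in> level k" and w: "w \<in> level k" and u: "mat_adjoint w * w = 1\<^sub>m (2 ^ k)"
  shows "norm (\<pi> (w * a) \<Omega>) = norm (\<pi> a \<Omega>)"
proof -
  have "mat_adjoint (w * a) * (w * a) = mat_adjoint a * ((mat_adjoint w * w) * a)"
    using a w by (simp add: mat_adjoint_mult assoc_mult_mat[of _ "2^k" "2^k" _ "2^k" _ "2^k"])
  also have "\<dots> = mat_adjoint a * a" unfolding u left_mult_one_mat[OF a] ..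
  finally show ?thesis using norm_rep[OF a] norm_rep[OF mult_carrier_mat[OF w a]] by simp
qed

text \<open>The trace property makes right multiplication by unitaries isometric.\<close>

lemma norm_rep_unitary_right:
  assumes a: "a \<in> level k" and w: "w \<in> level k" and u: "w * mat_adjoint w = 1\<^sub>m (2 ^ k)"
  shows "norm (\<pi> (a * w) \<Omega>) = norm (\<pi> a \<Omega>)"
proof -
  define a' w' where "a' = mat_adjoint a" and "w' = mat_adjoint w"
  have c: "a' \<in> level k" "w' \<in> level k" using a w by (simp_all add: a'_def w'_def)
  note as = assoc_mult_mat[of _ "2^k" "2^k" _ "2^k" _ "2^k"]
  have "normalized_trace (mat_adjoint (a * w) * (a * w)) = normalized_trace (w' * (a' * a * w))"
    using a w c by (simp add: mat_adjoint_mult as flip: a'_def w'_def)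
  also have "\<dots> = normalized_trace ((a' * a * w) * w')"
    using a w c by (intro normalized_trace_mult_commute mult_carrier_mat) 
  also have "(a' * a * w) * w' = a' * a * (w * w')" using a w c by (simp add: as)
  also have "\<dots> = a' * a" unfolding w'_def u by (rule right_mult_one_mat[OF mult_carrier_mat[OF c(1) a]])
  finally show ?thesis using norm_rep[OF a] norm_rep[OF mult_carrier_mat[OF a w]] by (simp add: a'_def)
qed

lemma norm_rep_reflect:
  assumes "a \<in> level (Suc k)"
  shows "norm (\<pi> (reflect \<alpha> k a) \<Omega>) = norm (\<pi> a \<Omega>)"
  unfolding reflect_def
  using norm_rep_unitary_left[OF assms, of "parity \<alpha> k"]
    norm_rep_unitary_right[OF mult_carrier_mat[OF parity_carrier assms], of "parity \<alpha> k"]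
  by (simp add: parity_carrier[simplified])

text \<open>Since \<open>\<theta>\<^sub>\<alpha>\<close> preserves the trace, \<open>\<pi> a \<Omega> \<mapsto> \<pi> (\<theta>\<^sub>\<alpha> a) \<Omega>\<close> is a well-defined isometry on a dense
  subspace.\<close>

lemma reflection_exists:
  "\<exists>V :: 'h \<Rightarrow>\<^sub>L 'h. clinear_op V \<and> (\<forall>x. norm (V x) = norm x) \<and>
     (\<forall>k. \<forall>a\<in>level (Suc k). V (\<pi> a \<Omega>) = \<pi> (reflect \<alpha> k a) \<Omega>)"
proof -
  define f where "f x = (SOME y. \<exists>k. \<exists>a\<in>level (Suc k). x = \<pi> a \<Omega> \<and> y = \<pi> (reflect \<alpha> k a) \<Omega>)" for x
  have f: "f (\<pi> a \<Omega>) = \<pi> (reflect \<alpha> k a) \<Omega>" if a: "a \<in> level (Suc k)" for a k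
  proof -
    have "\<exists>l. \<exists>b\<in>level (Suc l). \<pi> a \<Omega> = \<pi> b \<Omega> \<and> f (\<pi> a \<Omega>) = \<pi> (reflect \<alpha> l b) \<Omega>"
      unfolding f_def by (rule someI_ex) (use a in blast)
    then obtain l b where b: "b \<in> level (Suc l)" "\<pi> a \<Omega> = \<pi> b \<Omega>" "f (\<pi> a \<Omega>) = \<pi> (reflect \<alpha> l b) \<Omega>" by blast
    obtain K a' b' where ab: "a' \<in> level (Suc K)" "b' \<in> level (Suc K)" "\<pi> a' = \<pi> a" "\<pi> b' = \<pi> b"
      "\<pi> (reflect \<alpha> K a') = \<pi> (reflect \<alpha> k a)" "\<pi> (reflect \<alpha> K b') = \<pi> (reflect \<alpha> l b)"
      by (rule rep_raise2[OF a b(1)]) blast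
    define c where "c = a' + (-1) \<cdot>\<^sub>m b'"
    have c: "c \<in> level (Suc K)" using ab by (simp add: c_def)
    have diff: "\<pi> (p + (-1) \<cdot>\<^sub>m q) \<Omega> = \<pi> p \<Omega> - \<pi> q \<Omega>" if "p \<in> level (Suc K)" "q \<in> level (Suc K)" for p q
      using that rep_add[OF that(1), of "(-1) \<cdot>\<^sub>m q"] rep_smult[OF that(2), of "-1"]
      by (simp add: blinfun.add_left scalar_op_apply scaleC_minus1)
    have "norm (\<pi> (reflect \<alpha> K c) \<Omega>) = norm (\<pi> c \<Omega>)" by (rule norm_rep_reflect[OF c])
    also have "\<pi> c \<Omega> = 0" using diff[OF ab(1,2)] ab b by (simp add: c_def)
    finally have "\<pi> (reflect \<alpha> K c) \<Omega> = 0" by simp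
    moreover have "reflect \<alpha> K c = reflect \<alpha> K a' + (-1) \<cdot>\<^sub>m reflect \<alpha> K b'"
      unfolding c_def using ab reflect_smult[OF ab(2), of \<alpha> "-1"] by (subst reflect_add) auto
    ultimately have "\<pi> (reflect \<alpha> K a') \<Omega> = \<pi> (reflect \<alpha> K b') \<Omega>"
      using diff[OF reflect_carrier[OF ab(1)] reflect_carrier[OF ab(2)], of \<alpha> \<alpha>] by simp
    then show ?thesis using ab b by simp
  qed
  have "\<exists>V :: 'h \<Rightarrow>\<^sub>L 'h. clinear_op V \<and> (\<forall>x. norm (V x) = norm x) \<and> (\<forall>x\<in>dense_vectors. V x = f x)"
  proof (rule isometry_extension[OF dense_vectors_dense])
    fix x y assume "x \<in> dense_vectors" "y \<in> dense_vectors"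
    then obtain k a l b where ab: "a \<in> level (Suc k)" "b \<in> level (Suc l)" "x = \<pi> a \<Omega>" "y = \<pi> b \<Omega>"
      unfolding dense_vectors_def by blast
    obtain K a' b' where ab': "a' \<in> level (Suc K)" "b' \<in> level (Suc K)" "\<pi> a' = \<pi> a" "\<pi> b' = \<pi> b"
      by (rule rep_raise2[OF ab(1,2)]) blast
    have x: "x = \<pi> a' \<Omega>" and y: "y = \<pi> b' \<Omega>" using ab ab' by auto
    have xy: "x + y = \<pi> (a' + b') \<Omega>"
      using rep_add[OF ab'(1,2)] by (simp add: x y blinfun.add_left)
    then show "x + y \<in> dense_vectors" unfolding dense_vectors_def using ab' add_carrier_mat by blast
    show "f (x + y) = f x + f y"
      unfolding xy unfolding x y f[OF ab'(1)] f[OF ab'(2)] f[OF add_carrier_mat[OF ab'(2)]]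
        reflect_add[OF ab'(1,2)] rep_add[OF reflect_carrier[OF ab'(1)] reflect_carrier[OF ab'(2)]]
      by (rule blinfun.add_left)
  next
    fix c x assume "x \<in> dense_vectors"
    then obtain k a where a: "a \<in> level (Suc k)" "x = \<pi> a \<Omega>" unfolding dense_vectors_def by blast
    have cx: "c *\<^sub>C x = \<pi> (c \<cdot>\<^sub>m a) \<Omega>" using rep_smult[OF a(1)] a(2) by (simp add: scalar_op_apply)
    then show "c *\<^sub>C x \<in> dense_vectors" unfolding dense_vectors_def using a smult_carrier_mat by blast
    show "f (c *\<^sub>C x) = c *\<^sub>C f x"
      unfolding cx unfolding a(2) using a(1)
      by (simp add: f[of _ k] reflect_smult rep_smult[OF reflect_carrier] scalar_op_apply del: power_Suc)
  next
    fix x assume "x \<in> dense_vectors"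
    then obtain k a where a: "a \<in> level (Suc k)" "x = \<pi> a \<Omega>" unfolding dense_vectors_def by blast
    then show "norm (f x) = norm x" by (simp add: f[OF a(1)] norm_rep_reflect[OF a(1)])
  qed
  then show ?thesis using f unfolding dense_vectors_def by (metis (mono_tags, lifting) mem_Collect_eq)
qed

text \<open>The self-adjoint unitary implementing \<open>\<theta>\<^sub>\<alpha>\<close>.\<close>

definition V :: "real \<Rightarrow> 'h \<Rightarrow>\<^sub>L 'h" where
  "V \<alpha> = (SOME V. clinear_op V \<and> (\<forall>x. norm (V x) = norm x) \<and>
     (\<forall>k. \<forall>a\<in>level (Suc k). V (\<pi> a \<Omega>) = \<pi> (reflect \<alpha> k a) \<Omega>))"

lemma V_clinear: "clinear_op (V \<alpha>)" and norm_V [simp]: "norm (V \<alpha> x) = norm x"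
  and V_rep_\<Omega>: "a \<in> level (Suc k) \<Longrightarrow> V \<alpha> (\<pi> a \<Omega>) = \<pi> (reflect \<alpha> k a) \<Omega>"
  using someI_ex[OF reflection_exists[of \<alpha>]] unfolding V_def by blast+

lemma V_V [simp]: "V \<alpha> (V \<alpha> x) = x"
  using dense_vectors_dense
proof (induct x rule: dense_induct)
  case closed
  show ?case by (intro closed_Collect_eq continuous_intros)
next
  case (dense x)
  then obtain a k where a: "a \<in> level (Suc k)" "x = \<pi> a \<Omega>" unfolding dense_vectors_def by blast
  show ?case unfolding a(2) V_rep_\<Omega>[OF a(1)] V_rep_\<Omega>[OF reflect_carrier[OF a(1)]]
      reflect_involution[OF a(1)] ..
qed

lemma cinner_V: "cinner (V \<alpha> x) (V \<alpha> y) = cinner x y"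
  by (rule isometry_cinner[OF V_clinear]) simp

lemma cinner_V_left: "cinner (V \<alpha> x) y = cinner x (V \<alpha> y)"
  using cinner_V[of \<alpha> x "V \<alpha> y"] by simp

lemma V_\<Omega> [simp]: "V \<alpha> \<Omega> = \<Omega>"
  using V_rep_\<Omega>[OF one_carrier_mat, of \<alpha> 0] by (simp add: reflect_one[of _ 0, simplified] rep_one[of 0, simplified])

lemma V_rep_V:
  assumes a: "a \<in> level (Suc k)"
  shows "V \<alpha> (\<pi> a (V \<alpha> x)) = \<pi> (reflect \<alpha> k a) x"
  using dense_vectors_dense
proof (induct x rule: dense_induct)
  case closed
  show ?case by (intro closed_Collect_eq continuous_intros)
next
  case (dense x)
  then obtain b l where b: "b \<in> level (Suc l)" "x = \<pi> b \<Omega>" unfolding dense_vectors_def by blast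
  obtain K a' b' where ab: "a' \<in> level (Suc K)" "b' \<in> level (Suc K)" "\<pi> a' = \<pi> a" "\<pi> b' = \<pi> b"
      "\<And>\<alpha>. \<pi> (reflect \<alpha> K a') = \<pi> (reflect \<alpha> k a)"
    by (rule rep_raise2[OF a b(1)]) blast
  note r = reflect_carrier[OF ab(2), of \<alpha>]
  have "V \<alpha> (\<pi> a (V \<alpha> x)) = V \<alpha> (\<pi> (a' * reflect \<alpha> K b') \<Omega>)"
    using V_rep_\<Omega>[OF ab(2), of \<alpha>] rep_mult[OF ab(1) r] ab b by simp
  also have "\<dots> = \<pi> (reflect \<alpha> K a' * b') \<Omega>"
    unfolding V_rep_\<Omega>[OF mult_carrier_mat[OF ab(1) r]] reflect_mult[OF ab(1) r] reflect_involution[OF ab(2)] ..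
  also have "\<dots> = \<pi> (reflect \<alpha> k a) x"
    using rep_mult[OF reflect_carrier[OF ab(1)] ab(2)] ab b by simp
  finally show ?case .
qed

end

section \<open>Spin model subfactors as fixed-point algebras\<close>

context gns begin

abbreviation "R \<equiv> hyperfinite_factor 2 \<pi>"
abbreviation "P \<alpha> \<equiv> spin_subfactor 2 \<pi> (hadamard2 \<alpha>)"

text \<open>The average of \<open>T\<close> and its image under the automorphism.  It is defined on all bounded operators
  and weakly continuous, so that its values on the weak closure are controlled by those on matrices.\<close>

definition E :: "real \<Rightarrow> ('h \<Rightarrow>\<^sub>L 'h) \<Rightarrow> ('h \<Rightarrow>\<^sub>L 'h)" where
  "E \<alpha> T = (1/2) *\<^sub>R (T + (V \<alpha> o\<^sub>L T o\<^sub>L V \<alpha>))"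

lemma E_apply: "E \<alpha> T x = (1/2) *\<^sub>R (T x + V \<alpha> (T (V \<alpha> x)))"
  by (simp add: E_def blinfun.bilinear_simps)

lemma cinner_E:
  "cinner (E \<alpha> T x) y = 1/2 * cinner (T x) y + 1/2 * cinner (T (V \<alpha> x)) (V \<alpha> y)"
  by (simp add: E_apply cinner_simps cinner_V_left algebra_simps)

lemma continuous_map_E: "continuous_map weak_operator_topology weak_operator_topology (E \<alpha>)"
  by (rule continuous_map_into_wot)
    (simp only: cinner_E, intro continuous_map_add continuous_map_cmult_left continuous_map_wot_coord)

definition matrix_union :: "('h \<Rightarrow>\<^sub>L 'h) set" where
  "matrix_union = (\<Union>k. \<pi> ` level k)"

definition spin_union :: "real \<Rightarrow> ('h \<Rightarrow>\<^sub>L 'h) set" where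
  "spin_union \<alpha> = (\<Union>k\<in>{1..}. (\<lambda>x. \<pi> (spin_u 2 (hadamard2 \<alpha>) k * (x \<otimes>\<^sub>m 1\<^sub>m 2) *
   mat_adjoint (spin_u 2 (hadamard2 \<alpha>) k))) ` level k)"

lemma R_eq: "R = weak_operator_topology closure_of matrix_union"
  by (simp add: hyperfinite_factor_def matrix_union_def)

lemma P_eq: "P \<alpha> = weak_operator_topology closure_of spin_union \<alpha>"
  by (simp add: spin_subfactor_def spin_union_def)

lemma rep_in_R: "a \<in> level k \<Longrightarrow> \<pi> a \<in> R"
  unfolding R_eq using closure_of_subset[of matrix_union weak_operator_topology]
  by (auto simp: matrix_union_def)

lemma spin_union_fixed:
  assumes "T \<in> spin_union \<alpha>"
  shows "\<exists>k. \<exists>a\<in>level (Suc k). T = \<pi> a \<and> reflect \<alpha> k a = a"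
proof -
  from assms obtain k x where x: "x \<in> level k" and T: "T = \<pi> (spin_u 2 (hadamard2 \<alpha>) k * (x \<otimes>\<^sub>m 1\<^sub>m 2) *
   mat_adjoint (spin_u 2 (hadamard2 \<alpha>) k))" (is "T = \<pi> ?a")
    unfolding spin_union_def by blast
  have a: "?a \<in> level (Suc k)"
    by (rule mult_carrier_mat[OF mult_carrier_mat[OF spin_u_carrier kron_level[OF x]]
          mat_adjoint_carrier[OF spin_u_carrier]])
  moreover have "reflect \<alpha> k ?a = ?a"
    unfolding reflect_fixed_iff[OF a] by (rule spin_generator_commutes_parity[OF x])
  ultimately show ?thesis using T by blast
qed

lemma P_subset_R: "P \<alpha> \<subseteq> R"
proof -
  have "T \<in> matrix_union" if T: "T \<in> spin_union \<alpha>" for T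
  proof -
    obtain k a where "a \<in> level (Suc k)" "T = \<pi> a" using spin_union_fixed[OF T] by metis
    then show ?thesis unfolding matrix_union_def by (intro UN_I[of "Suc k"]) simp_all
  qed
  then show ?thesis unfolding P_eq R_eq by (intro closure_of_mono subsetI)
qed

lemma R_clinear: "T \<in> R \<Longrightarrow> clinear_op T"
proof -
  assume T: "T \<in> R"
  have "cinner (T (c *\<^sub>C x)) y = c * cinner (T x) y" for c x y
    using T unfolding R_eq
    by (rule wot_closure_eqI)
      (auto intro!: continuous_map_wot_coord continuous_map_cmult_left
        simp: matrix_union_def dest!: rep_clinear simp: clinear_op_def cinner_scaleC_left)
  then have "T (c *\<^sub>C x) = c *\<^sub>C T x" for c x
    by (intro cinner_ext[of "T (c *\<^sub>C x)"]) (simp add: cinner_scaleC_left)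
  then show ?thesis by (simp add: clinear_op_def)
qed

text \<open>The easy half of the fixed-point description: invariance holds for the conjugated matrix
  algebras and is weakly closed.\<close>

lemma P_fixed:
  assumes T: "T \<in> P \<alpha>"
  shows "V \<alpha> (T (V \<alpha> x)) = T x"
proof (rule cinner_ext)
  fix y
  have "cinner (T (V \<alpha> x)) (V \<alpha> y) = cinner (T x) y"
    using T unfolding P_eq
  proof (rule wot_closure_eqI)
    fix T assume "T \<in> spin_union \<alpha>"
    then obtain k a where a: "a \<in> level (Suc k)" "T = \<pi> a" "reflect \<alpha> k a = a" using spin_union_fixed by blast
    have "V \<alpha> (T (V \<alpha> x)) = T x" unfolding a(2) V_rep_V[OF a(1)] a(3) ..
    then show "cinner (T (V \<alpha> x)) (V \<alpha> y) = cinner (T x) y" by (simp flip: cinner_V_left)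
  qed (rule continuous_map_wot_coord)+
  then show "cinner (V \<alpha> (T (V \<alpha> x))) y = cinner (T x) y" by (simp add: cinner_V_left)
qed

lemma P_commute: "T \<in> P \<alpha> \<Longrightarrow> V \<alpha> (T x) = T (V \<alpha> x)"
  using P_fixed[of T \<alpha> "V \<alpha> x"] by simp

lemma E_fixed: "T \<in> P \<alpha> \<Longrightarrow> E \<alpha> T = T"
  by (rule blinfun_eqI) (simp add: E_apply P_fixed scaleR_add_right[symmetric] flip: scaleR_2)

text \<open>The average of a matrix and its image commutes with the parity operator, hence lies in one of
  the conjugated matrix algebras, one level up.\<close>

lemma E_matrix_union:
  assumes "T \<in> matrix_union"
  shows "E \<alpha> T \<in> spin_union \<alpha>"
proof -
  obtain k a0 where a0: "a0 \<in> level k" "T = \<pi> a0" using assms unfolding matrix_union_def by blast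
  obtain a where a: "a \<in> level (Suc k)" "T = \<pi> a" using rep_level_Suc[OF a0(1)] a0(2) by metis
  \<comment> \<open>the average taken at the level of matrices\<close>
  define y where "y = (1/2) \<cdot>\<^sub>m (a + reflect \<alpha> k a)"
  note r = reflect_carrier[OF a(1), of \<alpha>]
  have s: "a + reflect \<alpha> k a \<in> level (Suc k)" by (rule add_carrier_mat[OF r])
  have y: "y \<in> level (Suc k)" unfolding y_def by (rule smult_carrier_mat[OF s])
  have "reflect \<alpha> k y = y"
    unfolding y_def reflect_smult[OF s] reflect_add[OF a(1) r] reflect_involution[OF a(1)]
    using comm_add_mat[OF a(1) r] by simp
  then obtain x where x: "x \<in> level (Suc k)" "y \<otimes>\<^sub>m 1\<^sub>m 2 = spin_u 2 (hadamard2 \<alpha>) (Suc k) * (x \<otimes>\<^sub>m 1\<^sub>m 2)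
    * mat_adjoint (spin_u 2 (hadamard2 \<alpha>) (Suc k))"
    using parity_commutant_is_spin_generator[OF y] unfolding reflect_fixed_iff[OF y] by blast
  have "E \<alpha> T = \<pi> y"
  proof (rule blinfun_eqI)
    fix v
    show "E \<alpha> T v = \<pi> y v"
      unfolding y_def rep_smult[OF s] rep_add[OF a(1) r] a(2) E_apply V_rep_V[OF a(1)]
      by (simp add: blinfun.add_left scalar_op_apply scaleR_scaleC)
  qed
  also have "\<dots> = \<pi> (y \<otimes>\<^sub>m 1\<^sub>m 2)" by (rule rep_kron[OF y, symmetric])
  finally have "E \<alpha> T = \<pi> (spin_u 2 (hadamard2 \<alpha>) (Suc k) * (x \<otimes>\<^sub>m 1\<^sub>m 2)
    * mat_adjoint (spin_u 2 (hadamard2 \<alpha>) (Suc k)))" unfolding x(2) .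
  then show ?thesis unfolding spin_union_def using x(1) by (intro UN_I[of "Suc k"]) auto
qed

text \<open>The other half of the fixed-point description, by weak continuity of \<open>E\<close>.\<close>

lemma E_in_P:
  assumes "T \<in> R"
  shows "E \<alpha> T \<in> P \<alpha>"
proof -
  have "E \<alpha> T \<in> E \<alpha> ` (weak_operator_topology closure_of matrix_union)" using assms unfolding R_eq by blast
  also have "\<dots> \<subseteq> weak_operator_topology closure_of (E \<alpha> ` matrix_union)"
    by (rule continuous_map_image_closure_subset[OF continuous_map_E])
  also have "\<dots> \<subseteq> P \<alpha>" unfolding P_eq using E_matrix_union by (intro closure_of_mono) blast
  finally show ?thesis .
qed

lemma rep_in_P:
  assumes a: "a \<in> level (Suc k)" and "reflect \<alpha> k a = a"
  shows "\<pi> a \<in> P \<alpha>"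
proof -
  have "E \<alpha> (\<pi> a) = \<pi> a"
    by (rule blinfun_eqI) (simp add: E_apply V_rep_V[OF a] assms(2) scaleR_add_right[symmetric] flip: scaleR_2)
  then show ?thesis using E_in_P[OF rep_in_R[OF a], of \<alpha>] by simp
qed

lemma equator_level: "equator \<alpha> \<in> level (Suc 0)"
  by simp

lemma equator_in_P: "\<pi> (equator \<alpha>) \<in> P \<alpha>"
  by (rule rep_in_P[of _ 0]) (simp_all add: reflect_equator)

lemma id_in_P: "id_blinfun \<in> P \<alpha>"
  using rep_in_P[OF one_carrier_mat, of \<alpha> 0] unfolding rep_one reflect_one by simp

lemma zero_in_P: "0 \<in> P \<alpha>"
proof -
  have "\<pi> (0 \<cdot>\<^sub>m equator \<alpha>) = 0"
    by (rule blinfun_eqI)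
      (simp add: rep_smult[OF equator_level] scalar_op_apply scaleC_zero)
  moreover have "0 \<cdot>\<^sub>m equator \<alpha> \<in> level (Suc 0)" by simp
  ultimately have "0 \<in> R" using rep_in_R by metis
  then have "E \<alpha> 0 \<in> P \<alpha>" by (rule E_in_P)
  moreover have "E \<alpha> 0 = 0" by (simp add: E_def)
  ultimately show ?thesis by simp
qed

lemma E_trace_cond_exp: "trace_cond_exp \<Omega> R (P \<alpha>) (E \<alpha>)"
  unfolding trace_cond_exp_def
proof (intro conjI ballI allI impI)
  fix x y c
  show "E \<alpha> x \<in> P \<alpha>" if "x \<in> R" using that by (rule E_in_P)
  show "E \<alpha> x = x" if "x \<in> P \<alpha>" using that by (rule E_fixed)
  show "E \<alpha> (x + y) = E \<alpha> x + E \<alpha> y"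
    by (rule blinfun_eqI) (simp add: E_apply blinfun.bilinear_simps scaleR_add_right)
  show "E \<alpha> (scalar_op c o\<^sub>L x) = scalar_op c o\<^sub>L E \<alpha> x"
    using V_clinear[of \<alpha>]
    by (intro blinfun_eqI)
      (simp add: E_apply clinear_op_def scalar_op_apply scaleR_scaleC scaleC_add_right scaleC_scaleC mult.commute)
  show "positive_op (E \<alpha> x)" if "positive_op x"
    unfolding positive_op_def
  proof
    fix v
    have "cinner (x v) v \<in> \<real>\<^sub>\<ge>\<^sub>0" "cinner (x (V \<alpha> v)) (V \<alpha> v) \<in> \<real>\<^sub>\<ge>\<^sub>0"
      using that by (simp_all add: positive_op_def)
    then have "1/2 * cinner (x v) v + 1/2 * cinner (x (V \<alpha> v)) (V \<alpha> v) \<in> \<real>\<^sub>\<ge>\<^sub>0"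
      by (intro nonneg_Reals_add_I nonneg_Reals_mult_I) auto
    then show "cinner (E \<alpha> x v) v \<in> \<real>\<^sub>\<ge>\<^sub>0" unfolding cinner_E .
  qed
  show "E \<alpha> (a o\<^sub>L x o\<^sub>L b) = a o\<^sub>L E \<alpha> x o\<^sub>L b" if "a \<in> P \<alpha>" "b \<in> P \<alpha>" for a b
    using that by (intro blinfun_eqI) (simp add: E_apply P_commute[OF that(1)] blinfun.bilinear_simps flip: P_commute[OF that(2)])
  show "vtrace \<Omega> (E \<alpha> x) = vtrace \<Omega> x"
    by (simp add: vtrace_def cinner_E)
qed

end

section \<open>Commuting squares\<close>

text \<open>Commuting conditional expectations compose to one onto the intersection.\<close>

lemma trace_cond_exp_compose:
  assumes P: "trace_cond_exp \<Omega> M P E" and Q: "trace_cond_exp \<Omega> M Q F"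
    and sub: "P \<subseteq> M" "Q \<subseteq> M" and comm: "\<And>x. x \<in> M \<Longrightarrow> E (F x) = F (E x)"
  shows "trace_cond_exp \<Omega> M (P \<inter> Q) (\<lambda>x. E (F x))"
proof -
  have F: "F x \<in> M" if "x \<in> M" for x using Q sub that unfolding trace_cond_exp_def by blast
  have "E (F x) \<in> P \<inter> Q" if "x \<in> M" for x
  proof -
    have "E (F x) \<in> P" using P F[OF that] unfolding trace_cond_exp_def by blast
    moreover have "E x \<in> M" using P sub that unfolding trace_cond_exp_def by blast
    then have "F (E x) \<in> Q" using Q unfolding trace_cond_exp_def by blast
    ultimately show ?thesis using comm[OF that] by simp
  qed
  then show ?thesis using P Q F unfolding trace_cond_exp_def by simp
qed

context gns begin

lemma V_commute:
  assumes "cos (\<alpha> - \<beta>) = 0"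
  shows "V \<alpha> (V \<beta> x) = V \<beta> (V \<alpha> x)"
  using dense_vectors_dense
proof (induct x rule: dense_induct)
  case closed
  show ?case by (intro closed_Collect_eq continuous_intros)
next
  case (dense x)
  then obtain a k where a: "a \<in> level (Suc k)" "x = \<pi> a \<Omega>" unfolding dense_vectors_def by blast
  show ?case
    unfolding a(2) V_rep_\<Omega>[OF a(1)] V_rep_\<Omega>[OF reflect_carrier[OF a(1)]] reflect_commute[OF a(1) assms] ..
qed

text \<open>Orthogonal axes: the implementing unitaries commute, and so do the averages.\<close>

lemma commuting_square_if:
  assumes cos: "cos (\<alpha> - \<beta>) = 0"
  shows "commuting_square \<Omega> R (P \<alpha>) (P \<beta>) (P \<alpha> \<inter> P \<beta>)"
proof -
  have comm: "E \<alpha> (E \<beta> x) = E \<beta> (E \<alpha> x)" for x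
    by (rule blinfun_eqI)
      (simp add: E_apply blinfun.bilinear_simps V_commute[OF cos] scaleR_add_right)
  have "trace_cond_exp \<Omega> R (P \<alpha> \<inter> P \<beta>) (\<lambda>x. E \<alpha> (E \<beta> x))"
    by (rule trace_cond_exp_compose[OF E_trace_cond_exp E_trace_cond_exp P_subset_R P_subset_R comm])
  then show ?thesis
    unfolding commuting_square_def using P_subset_R E_trace_cond_exp
    by (intro conjI exI[of _ "\<lambda>x. E \<alpha> (E \<beta> x)"] exI[of _ "E \<alpha>"] exI[of _ "E \<beta>"] ballI)
      (simp_all add: comm)
qed

lemma vtrace_reflect:
  assumes z: "z \<in> P \<alpha>" and a: "a \<in> level (Suc k)"
  shows "vtrace \<Omega> (\<pi> (reflect \<alpha> k a) o\<^sub>L z) = vtrace \<Omega> (\<pi> a o\<^sub>L z)"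
proof -
  have "vtrace \<Omega> (\<pi> (reflect \<alpha> k a) o\<^sub>L z) = cinner (V \<alpha> (\<pi> a (V \<alpha> (z \<Omega>)))) \<Omega>"
    by (simp add: vtrace_def V_rep_V[OF a])
  also have "\<dots> = cinner (\<pi> a (z \<Omega>)) \<Omega>"
    using P_commute[OF z, of \<Omega>] by (simp add: cinner_V_left)
  finally show ?thesis by (simp add: vtrace_def)
qed

text \<open>The automorphism \<open>\<theta>\<^sub>\<alpha>\<close> changes the sign of the equatorial matrix perpendicular to \<open>\<sigma>\<^sub>\<alpha>\<close>.\<close>

lemma vtrace_equator_perp:
  assumes z: "z \<in> P \<alpha>"
  shows "vtrace \<Omega> (\<pi> (equator (\<alpha> + pi / 2)) o\<^sub>L z) = 0"
proof -
  have "equator (2 * \<alpha> - (\<alpha> + pi / 2)) = (-1) \<cdot>\<^sub>m equator (\<alpha> + pi / 2)"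
    by (rule eq_matI) (auto simp: equator_def complex_eq_iff cos_add sin_add cos_diff sin_diff)
  then have "vtrace \<Omega> (\<pi> ((-1) \<cdot>\<^sub>m equator (\<alpha> + pi / 2)) o\<^sub>L z) = vtrace \<Omega> (\<pi> (equator (\<alpha> + pi / 2)) o\<^sub>L z)"
    using vtrace_reflect[OF z equator_level, of "\<alpha> + pi / 2"] by (simp add: reflect_equator)
  moreover have "vtrace \<Omega> (\<pi> ((-1) \<cdot>\<^sub>m equator (\<alpha> + pi / 2)) o\<^sub>L z) = - vtrace \<Omega> (\<pi> (equator (\<alpha> + pi / 2)) o\<^sub>L z)"
    unfolding rep_smult[OF equator_level] by (simp add: vtrace_def scalar_op_apply cinner_scaleC_left)
  ultimately show ?thesis by simp
qed

text \<open>An element of both algebras is orthogonal to the perpendiculars of both axes, and these span all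
  equatorial matrices when the axes are different.\<close>

lemma vtrace_equator_Int:
  assumes z: "z \<in> P \<alpha> \<inter> P \<beta>" and sin: "sin (\<beta> - \<alpha>) \<noteq> 0"
  shows "vtrace \<Omega> (\<pi> (equator t) o\<^sub>L z) = 0"
proof -
  have lin: "vtrace \<Omega> (\<pi> (c \<cdot>\<^sub>m equator s) o\<^sub>L z) = c * vtrace \<Omega> (\<pi> (equator s) o\<^sub>L z)" for c s
    unfolding rep_smult[OF equator_level] by (simp add: vtrace_def scalar_op_apply cinner_scaleC_left)
  have "of_real (sin (\<beta> - \<alpha>)) \<cdot>\<^sub>m equator t = of_real (sin ((\<beta> + pi/2) - t)) \<cdot>\<^sub>m equator (\<alpha> + pi/2)
      + of_real (sin (t - (\<alpha> + pi/2))) \<cdot>\<^sub>m equator (\<beta> + pi/2)"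
    using equator_combination[of "\<beta> + pi/2" "\<alpha> + pi/2" t] by simp
  then have "\<pi> (of_real (sin (\<beta> - \<alpha>)) \<cdot>\<^sub>m equator t) = \<pi> (of_real (sin ((\<beta> + pi/2) - t)) \<cdot>\<^sub>m equator (\<alpha> + pi/2))
      + \<pi> (of_real (sin (t - (\<alpha> + pi/2))) \<cdot>\<^sub>m equator (\<beta> + pi/2))"
    using rep_add[OF smult_carrier_mat[OF equator_level] smult_carrier_mat[OF equator_level]] by metis
  then have "vtrace \<Omega> (\<pi> (of_real (sin (\<beta> - \<alpha>)) \<cdot>\<^sub>m equator t) o\<^sub>L z)
    = vtrace \<Omega> (\<pi> (of_real (sin ((\<beta> + pi/2) - t)) \<cdot>\<^sub>m equator (\<alpha> + pi/2)) o\<^sub>L z)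
      + vtrace \<Omega> (\<pi> (of_real (sin (t - (\<alpha> + pi/2))) \<cdot>\<^sub>m equator (\<beta> + pi/2)) o\<^sub>L z)"
    by (simp add: vtrace_def blinfun.add_left cinner_add_left)
  also have "\<dots> = 0" unfolding lin using z vtrace_equator_perp by simp
  finally show ?thesis unfolding lin using sin by simp
qed

lemma vtrace_equator_equator: "vtrace \<Omega> (\<pi> (equator \<alpha>) o\<^sub>L \<pi> (equator \<beta>)) = of_real (cos (\<alpha> - \<beta>))"
proof -
  have "vtrace \<Omega> (\<pi> (equator \<alpha>) o\<^sub>L \<pi> (equator \<beta>)) = normalized_trace (equator \<alpha> * equator \<beta>)"
    unfolding vtrace_def rep_mult[OF equator_level equator_level, symmetric]
    by (rule rep_trace[OF mult_carrier_mat[OF equator_level equator_level]])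
  also have "\<dots> = of_real (cos (\<beta> - \<alpha>))"
    unfolding equator_mult by (simp add: normalized_trace_def lessThan_atLeast0 sum2 phase_flip_def)
  finally show ?thesis by (metis cos_minus minus_diff_eq)
qed

text \<open>The conditional expectation \<open>E\<^sub>P\<close> of \<open>\<sigma>\<^sub>\<beta>\<close> is an element of the intersection whose pairing with
  \<open>\<sigma>\<^sub>\<alpha>\<close> is \<open>cos (\<alpha> - \<beta>)\<close>; by the preceding orthogonality the pairing is zero.\<close>

lemma cos_zero_if_commuting_square:
  assumes sq: "commuting_square \<Omega> R (P \<alpha>) (P \<beta>) (P \<alpha> \<inter> P \<beta>)" and sin: "sin (\<beta> - \<alpha>) \<noteq> 0"
  shows "cos (\<alpha> - \<beta>) = 0"
proof -
  obtain EN EP EQ where N: "trace_cond_exp \<Omega> R (P \<alpha> \<inter> P \<beta>) EN"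
    and EP: "trace_cond_exp \<Omega> R (P \<alpha>) EP" and EQ: "trace_cond_exp \<Omega> R (P \<beta>) EQ"
    and comm: "\<And>x. x \<in> R \<Longrightarrow> EP (EQ x) = EN x"
    using sq unfolding commuting_square_def by blast
  let ?x = "\<pi> (equator \<beta>)" and ?b = "\<pi> (equator \<alpha>)"
  have x: "?x \<in> R" by (rule rep_in_R[OF equator_level])
  have "EQ ?x = ?x" using EQ equator_in_P unfolding trace_cond_exp_def by blast
  then have z: "EP ?x \<in> P \<alpha> \<inter> P \<beta>" using comm[OF x] N x unfolding trace_cond_exp_def by metis
  have bx: "?b o\<^sub>L ?x \<in> R"
    using rep_in_R[OF mult_carrier_mat[OF equator_level equator_level]]
    unfolding rep_mult[OF equator_level equator_level] .
  have idr: "T o\<^sub>L id_blinfun = T" for T :: "'h \<Rightarrow>\<^sub>L 'h" by (rule blinfun_eqI) simp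
  have "EP (?b o\<^sub>L ?x) = ?b o\<^sub>L EP ?x"
    using EP equator_in_P[of \<alpha>] id_in_P[of \<alpha>] x unfolding trace_cond_exp_def by (metis idr)
  moreover have "vtrace \<Omega> (EP (?b o\<^sub>L ?x)) = vtrace \<Omega> (?b o\<^sub>L ?x)"
    using EP bx unfolding trace_cond_exp_def by blast
  ultimately have "vtrace \<Omega> (?b o\<^sub>L ?x) = 0" using vtrace_equator_Int[OF z sin] by simp
  then show ?thesis unfolding vtrace_equator_equator by simp
qed

end

section \<open>The Mashood-Taylor distance\<close>

text \<open>If \<open>p\<close> is a scalar plus \<open>s\<close> times \<open>z\<close>, then commutators with \<open>p\<close> are \<open>s\<close> times commutators with
  \<open>z\<close>.\<close>

lemma conj_eq_commutator:
  fixes a z p q :: "complex mat"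
  assumes a: "a \<in> carrier_mat n n" and z: "z \<in> carrier_mat n n" and q: "q \<in> carrier_mat n n"
    and p: "p = c \<cdot>\<^sub>m 1\<^sub>m n + s \<cdot>\<^sub>m z" and pq: "p * q = 1\<^sub>m n"
  shows "a - p * a * q = s \<cdot>\<^sub>m ((a * z - z * a) * q)"
proof -
  have pc: "p \<in> carrier_mat n n" unfolding p using z by auto
  have "a - p * a * q = a * (p * q) - p * a * q" unfolding pq using a by simp
  also have "\<dots> = (a * p - p * a) * q"
    using a q pc by (simp add: minus_mult_distrib_mat[of _ n n] assoc_mult_mat[of a n n p n q n])
  also have "a * p - p * a = s \<cdot>\<^sub>m (a * z - z * a)"
  proof -
    have az: "a * z \<in> carrier_mat n n" "z * a \<in> carrier_mat n n" using a z by auto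
    have "a * p = c \<cdot>\<^sub>m a + s \<cdot>\<^sub>m (a * z)"
      unfolding p using a z
      using mult_add_distrib_mat[of a n n "c \<cdot>\<^sub>m 1\<^sub>m n" n "s \<cdot>\<^sub>m z"]
        mult_smult_distrib[of a n n "1\<^sub>m n" n c] mult_smult_distrib[of a n n z n s] by simp
    moreover have "p * a = c \<cdot>\<^sub>m a + s \<cdot>\<^sub>m (z * a)"
      unfolding p using a z
      using add_mult_distrib_mat[of "c \<cdot>\<^sub>m 1\<^sub>m n" n n "s \<cdot>\<^sub>m z" a n]
        mult_smult_assoc_mat[of "1\<^sub>m n" n n a n c] mult_smult_assoc_mat[of z n n a n s] by simp
    moreover have "(c \<cdot>\<^sub>m a + s \<cdot>\<^sub>m A) - (c \<cdot>\<^sub>m a + s \<cdot>\<^sub>m B) = s \<cdot>\<^sub>m (A - B)"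
      if "A \<in> carrier_mat n n" "B \<in> carrier_mat n n" for A B
      using a that by (intro eq_matI) (auto simp: right_diff_distrib)
    ultimately show ?thesis using az by simp
  qed
  also have "s \<cdot>\<^sub>m (a * z - z * a) * q = s \<cdot>\<^sub>m ((a * z - z * a) * q)"
    using a z q by (intro mult_smult_assoc_mat[of _ n n]) auto
  finally show ?thesis .
qed

context gns begin

text \<open>The product of the two automorphisms is conjugation by \<open>cos \<gamma> + \<i> sin \<gamma> Z\<close> on the first site, so
  on \<open>\<pi> a \<Omega>\<close> its distance to the identity is \<open>\<bar>sin \<gamma>\<bar>\<close> times the norm of a commutator of \<open>a\<close> with a
  unitary.\<close>

lemma norm_V_V_diff:
  "norm (x - V \<beta> (V \<alpha> x)) \<le> 2 * \<bar>sin (\<alpha> - \<beta>)\<bar> * norm x"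
  using dense_vectors_dense
proof (induct x rule: dense_induct)
  case closed
  show ?case by (intro closed_Collect_le continuous_intros)
next
  case (dense x)
  then obtain a k where a: "a \<in> level (Suc k)" and x: "x = \<pi> a \<Omega>" unfolding dense_vectors_def by blast
  let ?n = "2 ^ Suc k"
  let ?z = "phase_flip_at k" and ?q = "parity \<alpha> k * parity \<beta> k" and ?p = "parity \<beta> k * parity \<alpha> k"
  note z = phase_flip_at_carrier[of k] and W = parity_carrier
  have q: "?q \<in> level (Suc k)" and p: "?p \<in> level (Suc k)" by (rule mult_carrier_mat[OF W W])+
  have inv: "(W * X) * (X * W) = 1\<^sub>m n"
    if "W \<in> carrier_mat n n" "X \<in> carrier_mat n n" "X * X = 1\<^sub>m n" "W * W = 1\<^sub>m n"
    for W X :: "complex mat" and n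
  proof -
    have "(W * X) * (X * W) = W * (X * X) * W"
      using that(1,2) by (simp add: assoc_mult_mat[of _ n n _ n _ n])
    then show ?thesis using that by simp
  qed
  have pq: "?p * ?q = 1\<^sub>m ?n" and qp: "?q * ?p = 1\<^sub>m ?n"
    by (rule inv[OF W W parity_square parity_square])+
  have qadj: "mat_adjoint ?q = ?p" by (simp add: mat_adjoint_mult)
  have az: "a * ?z \<in> level (Suc k)" and za: "?z * a \<in> level (Suc k)"
    by (rule mult_carrier_mat[OF a z], rule mult_carrier_mat[OF z a])
  have d: "a * ?z - ?z * a \<in> level (Suc k)" by (rule minus_carrier_mat[OF za])
  have dq: "(a * ?z - ?z * a) * ?q \<in> level (Suc k)" by (rule mult_carrier_mat[OF d q])
  have "x - V \<beta> (V \<alpha> x) = \<pi> (a - ?p * a * ?q) \<Omega>"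
    unfolding x V_rep_\<Omega>[OF a] V_rep_\<Omega>[OF reflect_carrier[OF a]] reflect_reflect[OF a]
    using rep_diff[OF a mult_carrier_mat[OF mult_carrier_mat[OF p a] q]] by (simp add: blinfun.diff_left)
  also have "a - ?p * a * ?q = (\<i> * of_real (sin (\<alpha> - \<beta>))) \<cdot>\<^sub>m ((a * ?z - ?z * a) * ?q)"
    by (rule conj_eq_commutator[OF a z q parity_mult pq])
  also have "norm (\<pi> \<dots> \<Omega>) = \<bar>sin (\<alpha> - \<beta>)\<bar> * norm (\<pi> ((a * ?z - ?z * a) * ?q) \<Omega>)"
    unfolding rep_smult[OF dq] by (simp add: scalar_op_apply norm_scaleC norm_mult)
  also have "norm (\<pi> ((a * ?z - ?z * a) * ?q) \<Omega>) = norm (\<pi> (a * ?z - ?z * a) \<Omega>)"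
    by (rule norm_rep_unitary_right[OF d q]) (unfold qadj, rule qp)
  also have "\<dots> = norm (\<pi> (a * ?z) \<Omega> - \<pi> (?z * a) \<Omega>)"
    unfolding rep_diff[OF az za] by (simp add: blinfun.diff_left)
  also have "\<dots> \<le> norm (\<pi> (a * ?z) \<Omega>) + norm (\<pi> (?z * a) \<Omega>)" by (rule norm_triangle_ineq4)
  also have "norm (\<pi> (a * ?z) \<Omega>) = norm x"
    unfolding x by (rule norm_rep_unitary_right[OF a z]) (unfold phase_flip_at_simps, rule refl)
  also have "norm (\<pi> (?z * a) \<Omega>) = norm x"
    unfolding x by (rule norm_rep_unitary_left[OF a z]) (unfold phase_flip_at_simps, rule refl)
  finally show ?case by (simp add: mult_left_mono)
qed

lemma norm2_diff:
  assumes "x \<in> P \<alpha>" "y \<in> P \<beta>"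
  shows "norm2 \<Omega> (x - y) = norm (x \<Omega> - y \<Omega>)"
proof -
  have "clinear_op (x - y)"
    using assms P_subset_R R_clinear by (intro clinear_diff) blast+
  then show ?thesis by (simp add: norm2_eq blinfun.diff_left)
qed

abbreviation "unit_ball \<alpha> \<equiv> op_unit_ball (P \<alpha>)"

lemma ball_norm: "x \<in> unit_ball \<alpha> \<Longrightarrow> norm (x \<Omega>) \<le> 1"
  using norm_blinfun[of x \<Omega>] by (auto simp: op_unit_ball_def norm_\<Omega>)

lemma zero_in_ball: "0 \<in> unit_ball \<alpha>"
  by (simp add: op_unit_ball_def zero_in_P)

lemma E_in_ball:
  assumes x: "x \<in> unit_ball \<alpha>"
  shows "E \<beta> x \<in> unit_ball \<beta>"
proof -
  have n: "norm x \<le> 1" and xP: "x \<in> P \<alpha>" using x by (simp_all add: op_unit_ball_def)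
  have b: "norm (x v) \<le> norm v" for v
    using norm_blinfun[of x v] mult_right_mono[OF n norm_ge_zero[of v]] by simp
  have "norm (E \<beta> x) \<le> 1"
  proof (rule norm_blinfun_bound)
    fix v
    have "norm (x v + V \<beta> (x (V \<beta> v))) \<le> norm v + norm v"
      using norm_triangle_ineq[of "x v" "V \<beta> (x (V \<beta> v))"] b[of v] b[of "V \<beta> v"] by simp
    then show "norm (E \<beta> x v) \<le> 1 * norm v" by (simp add: E_apply)
  qed simp
  then show ?thesis using xP P_subset_R E_in_P by (auto simp: op_unit_ball_def)
qed

text \<open>One of the two suprema in the Hausdorff distance, with the trace norm written as a norm of
  vectors.\<close>

definition one_sided_dist :: "real \<Rightarrow> real \<Rightarrow> real" where
  "one_sided_dist \<alpha> \<beta> = (SUP x\<in>unit_ball \<alpha>. INF y\<in>unit_ball \<beta>. norm (blinfun_apply x \<Omega> - blinfun_apply y \<Omega>))"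

lemma dist_MT_eq: "dist_MT \<Omega> (P \<alpha>) (P \<beta>) = max (one_sided_dist \<alpha> \<beta>) (one_sided_dist \<beta> \<alpha>)"
proof -
  have b: "x \<in> unit_ball \<delta> \<Longrightarrow> x \<in> P \<delta>" for x \<delta> by (simp add: op_unit_ball_def)
  have "(SUP x\<in>unit_ball \<alpha>. INF y\<in>unit_ball \<beta>. norm2 \<Omega> (x - y)) = one_sided_dist \<alpha> \<beta>"
    unfolding one_sided_dist_def by (intro SUP_cong INF_cong refl norm2_diff b)
  moreover have "(SUP y\<in>unit_ball \<beta>. INF x\<in>unit_ball \<alpha>. norm2 \<Omega> (x - y)) = one_sided_dist \<beta> \<alpha>"
    unfolding one_sided_dist_def
    by (intro SUP_cong INF_cong refl) (subst norm_minus_commute, intro norm2_diff b)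
  ultimately show ?thesis by (simp add: dist_MT_def)
qed

text \<open>The competitor is \<open>E \<beta> x\<close>.  As \<open>x\<close> is fixed by \<open>\<theta>\<^sub>\<alpha>\<close>, subtracting it from \<open>x\<close> leaves half of
  \<open>x - \<theta>\<^sub>\<beta> (\<theta>\<^sub>\<alpha> x)\<close>.\<close>

lemma INF_le_sin:
  assumes x: "x \<in> unit_ball \<alpha>"
  shows "(INF y\<in>unit_ball \<beta>. norm (x \<Omega> - blinfun_apply y \<Omega>)) \<le> \<bar>sin (\<alpha> - \<beta>)\<bar>"
proof -
  have xP: "x \<in> P \<alpha>" using x by (simp add: op_unit_ball_def)
  have "(INF y\<in>unit_ball \<beta>. norm (x \<Omega> - blinfun_apply y \<Omega>)) \<le> norm (x \<Omega> - E \<beta> x \<Omega>)"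
    by (intro cINF_lower E_in_ball[OF x] bdd_belowI2[of _ 0]) simp
  also have "x \<Omega> - E \<beta> x \<Omega> = (1/2) *\<^sub>R (x \<Omega> - V \<beta> (x \<Omega>))"
    by (simp add: E_apply algebra_simps flip: scaleR_add_left)
  also have "V \<beta> (x \<Omega>) = V \<beta> (V \<alpha> (x \<Omega>))" using P_commute[OF xP, of \<Omega>] by simp
  also have "norm ((1/2) *\<^sub>R (x \<Omega> - V \<beta> (V \<alpha> (x \<Omega>)))) \<le> \<bar>sin (\<alpha> - \<beta>)\<bar> * norm (x \<Omega>)"
    using norm_V_V_diff[of "x \<Omega>" \<beta> \<alpha>] by simp
  also have "\<dots> \<le> \<bar>sin (\<alpha> - \<beta>)\<bar>" using ball_norm[OF x] by (simp add: mult_left_le)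
  finally show ?thesis .
qed

lemma one_sided_dist_le: "one_sided_dist \<alpha> \<beta> \<le> \<bar>sin (\<alpha> - \<beta>)\<bar>"
  unfolding one_sided_dist_def using INF_le_sin zero_in_ball[of \<alpha>] by (intro cSUP_least) auto

lemma dist_MT_le: "dist_MT \<Omega> (P \<alpha>) (P \<beta>) \<le> \<bar>sin (\<alpha> - \<beta>)\<bar>"
proof -
  have "\<bar>sin (\<beta> - \<alpha>)\<bar> = \<bar>sin (\<alpha> - \<beta>)\<bar>" by (metis abs_minus minus_diff_eq sin_minus)
  then show ?thesis using one_sided_dist_le[of \<alpha> \<beta>] one_sided_dist_le[of \<beta> \<alpha>] by (simp add: dist_MT_eq)
qed

lemma norm_rep_equator: "norm (\<pi> (equator \<alpha>) x) = norm x"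
proof -
  have adj: "is_adjoint (\<pi> (equator \<alpha>)) (\<pi> (equator \<alpha>))"
    using rep_adjoint[OF equator_level, of \<alpha>] by simp
  have "\<pi> (equator \<alpha>) (\<pi> (equator \<alpha>) x) = \<pi> (equator \<alpha> * equator \<alpha>) x"
    unfolding rep_mult[OF equator_level equator_level] by simp
  also have "\<dots> = x" using rep_one[of 0] by simp
  finally show ?thesis
    using adj unfolding norm_eq_sqrt_cinner is_adjoint_def by simp
qed

lemma equator_in_ball: "\<pi> (equator \<alpha>) \<in> unit_ball \<alpha>"
proof -
  have "norm (\<pi> (equator \<alpha>)) \<le> 1" by (rule norm_blinfun_bound) (simp_all add: norm_rep_equator)
  then show ?thesis by (simp add: op_unit_ball_def equator_in_P)
qed

text \<open>For orthogonal axes \<open>\<theta>\<^sub>\<beta>\<close> maps \<open>\<sigma>\<^sub>\<alpha>\<close> to its negative, hence \<open>\<sigma>\<^sub>\<alpha>\<close> is orthogonal to everything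
  that \<open>\<theta>\<^sub>\<beta>\<close> fixes.\<close>

lemma one_sided_dist_ge:
  assumes cos: "cos (\<alpha> - \<beta>) = 0"
  shows "one_sided_dist \<alpha> \<beta> \<ge> 1"
proof -
  let ?x = "\<pi> (equator \<alpha>)"
  have "cos (2 * (\<alpha> - \<beta>)) = -1" "sin (2 * (\<alpha> - \<beta>)) = 0"
    unfolding cos_double_cos sin_double using cos by simp_all
  then have "cos (\<alpha> - 2 * (\<alpha> - \<beta>)) = - cos \<alpha>" "sin (\<alpha> - 2 * (\<alpha> - \<beta>)) = - sin \<alpha>"
    unfolding cos_diff[of \<alpha> "2 * (\<alpha> - \<beta>)"] sin_diff[of \<alpha> "2 * (\<alpha> - \<beta>)"] by simp_all
  moreover have "\<alpha> - 2 * (\<alpha> - \<beta>) = 2 * \<beta> - \<alpha>" by simp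
  ultimately have cs: "cos (2 * \<beta> - \<alpha>) = - cos \<alpha>" "sin (2 * \<beta> - \<alpha>) = - sin \<alpha>"
    by metis+
  have cs': "cos (\<alpha> - 2 * \<beta>) = - cos \<alpha>" "sin (\<alpha> - 2 * \<beta>) = sin \<alpha>"
    using cs cos_minus[of "2 * \<beta> - \<alpha>"] sin_minus[of "2 * \<beta> - \<alpha>"] by simp_all
  have "equator (2 * \<beta> - \<alpha>) = (-1) \<cdot>\<^sub>m equator \<alpha>"
    by (rule eq_matI) (auto simp: equator_def complex_eq_iff cs cs')
  then have "V \<beta> (?x \<Omega>) = \<pi> ((-1) \<cdot>\<^sub>m equator \<alpha>) \<Omega>"
    using V_rep_\<Omega>[OF equator_level, of \<beta> \<alpha>] by (simp add: reflect_equator)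
  then have Vx: "V \<beta> (?x \<Omega>) = - ?x \<Omega>"
    unfolding rep_smult[OF equator_level] by (simp add: scalar_op_apply scaleC_minus1)
  have one: "1 \<le> norm (?x \<Omega> - y \<Omega>)" if y: "y \<in> unit_ball \<beta>" for y
  proof -
    have "V \<beta> (y \<Omega>) = y \<Omega>" using P_commute[of y \<beta> \<Omega>] y by (simp add: op_unit_ball_def)
    then have "cinner (?x \<Omega>) (y \<Omega>) = - cinner (?x \<Omega>) (y \<Omega>)"
      using cinner_V[of \<beta> "?x \<Omega>" "y \<Omega>"] by (simp add: Vx cinner_minus_left)
    then have "(norm (?x \<Omega> - y \<Omega>))\<^sup>2 = 1 + (norm (y \<Omega>))\<^sup>2"
      unfolding norm_diff_sq by (simp add: norm_rep_equator norm_\<Omega>)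
    then have "1\<^sup>2 \<le> (norm (?x \<Omega> - y \<Omega>))\<^sup>2" by simp
    then show ?thesis by (rule power2_le_imp_le) simp
  qed
  have "1 \<le> (INF y\<in>unit_ball \<beta>. norm (?x \<Omega> - blinfun_apply y \<Omega>))"
    using zero_in_ball[of \<beta>] one by (intro cINF_greatest) auto
  also have "\<dots> \<le> one_sided_dist \<alpha> \<beta>"
    unfolding one_sided_dist_def
    by (intro cSUP_upper equator_in_ball bdd_aboveI2[of _ _ "\<bar>sin (\<alpha> - \<beta>)\<bar>"] INF_le_sin)
  finally show ?thesis .
qed

lemma dist_MT_eq_1_iff: "dist_MT \<Omega> (P \<alpha>) (P \<beta>) = 1 \<longleftrightarrow> cos (\<alpha> - \<beta>) = 0"
proof
  assume "dist_MT \<Omega> (P \<alpha>) (P \<beta>) = 1"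
  then have "1 \<le> \<bar>sin (\<alpha> - \<beta>)\<bar>" using dist_MT_le[of \<alpha> \<beta>] by simp
  then have "1 \<le> (sin (\<alpha> - \<beta>))\<^sup>2" by (metis abs_ge_zero one_le_power power2_abs)
  then show "cos (\<alpha> - \<beta>) = 0" using sin_cos_squared_add[of "\<alpha> - \<beta>"] by (smt (verit) zero_eq_power2 zero_le_power2)
next
  assume "cos (\<alpha> - \<beta>) = 0"
  then have "1 \<le> dist_MT \<Omega> (P \<alpha>) (P \<beta>)" using one_sided_dist_ge[of \<alpha> \<beta>] by (simp add: dist_MT_eq)
  then show "dist_MT \<Omega> (P \<alpha>) (P \<beta>) = 1" using dist_MT_le[of \<alpha> \<beta>] abs_sin_le_one[of "\<alpha> - \<beta>"] by linarith
qed

end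

section \<open>The equivalence\<close>

theorem theoremB:
  fixes \<pi> :: "complex mat \<Rightarrow> ('h::complex_hilbert_space \<Rightarrow>\<^sub>L 'h)"
    and \<Omega> :: 'h
    and \<alpha> \<beta> :: real
  assumes "gns_trace 2 \<pi> \<Omega>"
    and "\<alpha> \<in> {0..<pi}" and "\<beta> \<in> {0..<pi}" and "\<alpha> \<noteq> \<beta>"
  shows "commuting_square \<Omega> (hyperfinite_factor 2 \<pi>)
           (spin_subfactor 2 \<pi> (hadamard2 \<alpha>)) (spin_subfactor 2 \<pi> (hadamard2 \<beta>))
           (spin_subfactor 2 \<pi> (hadamard2 \<alpha>) \<inter> spin_subfactor 2 \<pi> (hadamard2 \<beta>))
         \<longleftrightarrow> dist_MT \<Omega> (spin_subfactor 2 \<pi> (hadamard2 \<alpha>)) (spin_subfactor 2 \<pi> (hadamard2 \<beta>)) = 1"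
proof -
  interpret gns \<pi> \<Omega> by unfold_locales (rule assms(1))
  have "sin (\<beta> - \<alpha>) \<noteq> 0"
  proof (cases "\<alpha> < \<beta>")
    case True
    then show ?thesis using assms sin_gt_zero[of "\<beta> - \<alpha>"] by auto
  next
    case False
    then have "0 < sin (\<alpha> - \<beta>)" using assms by (intro sin_gt_zero) auto
    then show ?thesis by (metis less_irrefl minus_diff_eq neg_0_equal_iff_equal sin_minus)
  qed
  then show ?thesis
    unfolding dist_MT_eq_1_iff using commuting_square_if cos_zero_if_commuting_square by blast
qed

end
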